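(* Let $\Omega$ be a bounded domain in $\mathbb{R}^m$. Let $\vec F=(F_1,\dots,F_m)\in W^1(\Omega)\cap L^1(\Omega)$ be a vector field and $H\in L^\infty(\Omega)$ a real function. Let $u,v\in W^{2,1}(\Omega)$ be two minimizers for $\mathcal{F}_H(\cdot)$ in $W^{1,1}(\Omega)$ with $u-v\in W_0^{2,1}(\Omega)$. Suppose that for some constant $C>0$, $|\nabla u+\vec F|\ge C$ and $|\nabla v+\vec F|\ge C$ (a.e.). Suppose either $\Theta_u$ is nonintegrable or $\Theta_v$ is nonintegrable. Then $u=v$ in $\Omega$ (a.e.).
   Context: $W^1(\Omega)$ denotes the space of weakly differentiable functions on $\Omega$ (locally integrable functions whose first weak derivatives exist as locally integrable functions), applied componentwise for vector fields. The generalized $p$-area is $\mathcal{F}_H(u) := \int_\Omega\{|\nabla u+\vec F|+Hu\}\,dx^1\wedge\cdots\wedge dx^m$ for $u\in W^{1,1}(\Omega)$. A function $u\in W^{1,1}(\Omega)$ is a minimizer for $\mathcal{F}_H$ in $W^{1,1}(\Omega)$ if $\mathcal{F}_H(u)\le\mathcal{F}_H(u+\varphi)$ for every $\varphi\in W_0^{1,1}(\Omega)$. For a twice weakly differentiable function $w$, $\Theta_w := dw+\sum_I F_I\,dx^I$ and $d\Theta_w=\sum_{I,J}\partial_J F_I\,dx^J\wedge dx^I$ (weak derivatives). $\Theta_w$ is called nonintegrable if $\Theta_w\wedge d\Theta_w\ne0$ a.e. in $\Omega$. The integer $m$ need not be even. *)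

theory Defs
  imports "HOL-Analysis.Analysis" "HOL-Combinatorics.Permutations"
begin

section \<open>Weak derivatives and Sobolev spaces\<close>

definition partial :: "'n \<Rightarrow> (real ^ 'n \<Rightarrow> real) \<Rightarrow> real ^ 'n \<Rightarrow> real" where
  "partial i f x = deriv (\<lambda>t. f (x + t *\<^sub>R axis i 1)) 0"

text \<open>A list of indices \<open>[i\<^sub>1, \<dots>, i\<^sub>k]\<close> stands for the differential operator
  \<open>\<partial>\<^bsub>i\<^sub>1\<^esub> \<dots> \<partial>\<^bsub>i\<^sub>k\<^esub>\<close> of order \<open>k\<close>; thus a multi-index is represented by each of its
  orderings.\<close>

primrec partials :: "'n list \<Rightarrow> (real ^ 'n \<Rightarrow> real) \<Rightarrow> real ^ 'n \<Rightarrow> real" where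
  "partials [] f = f"
| "partials (i # \<alpha>) f = partial i (partials \<alpha> f)"

definition smooth :: "(real ^ 'n::finite \<Rightarrow> real) \<Rightarrow> bool" where
  "smooth f \<longleftrightarrow> (\<forall>\<alpha> x. partials \<alpha> f differentiable (at x))"

text \<open>\<open>C\<^sub>c\<^sup>\<infinity>(\<Omega>)\<close>, each function being extended by zero to the whole space.\<close>

definition test_functions :: "(real ^ 'n::finite) set \<Rightarrow> (real ^ 'n \<Rightarrow> real) set" where
  "test_functions \<Omega> =
    {\<phi>. smooth \<phi> \<and> compact (closure {x. \<phi> x \<noteq> 0}) \<and> closure {x. \<phi> x \<noteq> 0} \<subseteq> \<Omega>}"

definition locally_integrable :: "(real ^ 'n::finite) set \<Rightarrow> (real ^ 'n \<Rightarrow> real) \<Rightarrow> bool" where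
  "locally_integrable \<Omega> f \<longleftrightarrow> (\<forall>K. compact K \<and> K \<subseteq> \<Omega> \<longrightarrow> set_integrable lebesgue K f)"

definition has_weak_deriv ::
  "(real ^ 'n::finite) set \<Rightarrow> 'n list \<Rightarrow> (real ^ 'n \<Rightarrow> real) \<Rightarrow> (real ^ 'n \<Rightarrow> real) \<Rightarrow> bool" where
  "has_weak_deriv \<Omega> \<alpha> f g \<longleftrightarrow>
    locally_integrable \<Omega> f \<and> locally_integrable \<Omega> g \<and>
    (\<forall>\<phi> \<in> test_functions \<Omega>.
      (LINT x:\<Omega>|lebesgue. f x * partials \<alpha> \<phi> x) =
      (- 1) ^ length \<alpha> * (LINT x:\<Omega>|lebesgue. g x * \<phi> x))"

text \<open>A representative of the weak derivative, which is unique only almost everywhere in \<open>\<Omega>\<close>.\<close>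

definition weak_deriv ::
  "(real ^ 'n::finite) set \<Rightarrow> 'n list \<Rightarrow> (real ^ 'n \<Rightarrow> real) \<Rightarrow> real ^ 'n \<Rightarrow> real" where
  "weak_deriv \<Omega> \<alpha> f = (SOME g. has_weak_deriv \<Omega> \<alpha> f g)"

definition weak_grad ::
  "(real ^ 'n::finite) set \<Rightarrow> (real ^ 'n \<Rightarrow> real) \<Rightarrow> real ^ 'n \<Rightarrow> real ^ 'n" where
  "weak_grad \<Omega> f x = (\<chi> i. weak_deriv \<Omega> [i] f x)"

definition L1 :: "(real ^ 'n::finite) set \<Rightarrow> (real ^ 'n \<Rightarrow> real) set" where
  "L1 \<Omega> = {f. set_integrable lebesgue \<Omega> f}"

definition Linf :: "(real ^ 'n::finite) set \<Rightarrow> (real ^ 'n \<Rightarrow> real) set" where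
  "Linf \<Omega> = {f. set_borel_measurable lebesgue \<Omega> f \<and>
    (\<exists>B. AE x\<in>\<Omega> in lebesgue. \<bar>f x\<bar> \<le> B)}"

text \<open>The spaces \<open>W\<^sup>k(\<Omega>)\<close> of \<open>k\<close> times weakly differentiable functions and \<open>W\<^bsup>k,1\<^esup>(\<Omega>)\<close>.
  The case \<open>\<alpha> = []\<close> says that \<open>f\<close> itself is locally integrable, respectively integrable.\<close>

definition W :: "nat \<Rightarrow> (real ^ 'n::finite) set \<Rightarrow> (real ^ 'n \<Rightarrow> real) set" where
  "W k \<Omega> = {f. \<forall>\<alpha>. length \<alpha> \<le> k \<longrightarrow> (\<exists>g. has_weak_deriv \<Omega> \<alpha> f g)}"

definition W1 :: "nat \<Rightarrow> (real ^ 'n::finite) set \<Rightarrow> (real ^ 'n \<Rightarrow> real) set" where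
  "W1 k \<Omega> = {f. \<forall>\<alpha>. length \<alpha> \<le> k \<longrightarrow> (\<exists>g \<in> L1 \<Omega>. has_weak_deriv \<Omega> \<alpha> f g)}"

text \<open>Mixed derivatives are counted once for every ordering, which gives a norm equivalent to
  the one that sums over multi-indices.\<close>

definition W1_norm :: "nat \<Rightarrow> (real ^ 'n::finite) set \<Rightarrow> (real ^ 'n \<Rightarrow> real) \<Rightarrow> real" where
  "W1_norm k \<Omega> f = (\<Sum>\<alpha> | length \<alpha> \<le> k. LINT x:\<Omega>|lebesgue. \<bar>weak_deriv \<Omega> \<alpha> f x\<bar>)"

text \<open>\<open>W\<^sub>0\<^bsup>k,1\<^esup>(\<Omega>)\<close>: the closure of the test functions in \<open>W\<^bsup>k,1\<^esup>(\<Omega>)\<close>.\<close>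

definition W1_0 :: "nat \<Rightarrow> (real ^ 'n::finite) set \<Rightarrow> (real ^ 'n \<Rightarrow> real) set" where
  "W1_0 k \<Omega> = {f \<in> W1 k \<Omega>. \<forall>\<epsilon>>0. \<exists>\<phi> \<in> test_functions \<Omega>. W1_norm k \<Omega> (\<lambda>x. f x - \<phi> x) < \<epsilon>}"

section \<open>The generalized p-area\<close>

definition p_area ::
  "(real ^ 'n::finite) set \<Rightarrow> (real ^ 'n \<Rightarrow> real ^ 'n) \<Rightarrow> (real ^ 'n \<Rightarrow> real) \<Rightarrow>
    (real ^ 'n \<Rightarrow> real) \<Rightarrow> real" where
  "p_area \<Omega> F H u = (LINT x:\<Omega>|lebesgue. norm (weak_grad \<Omega> u x + F x) + H x * u x)"

definition p_area_minimizer ::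
  "(real ^ 'n::finite) set \<Rightarrow> (real ^ 'n \<Rightarrow> real ^ 'n) \<Rightarrow> (real ^ 'n \<Rightarrow> real) \<Rightarrow>
    (real ^ 'n \<Rightarrow> real) \<Rightarrow> bool" where
  "p_area_minimizer \<Omega> F H u \<longleftrightarrow>
    u \<in> W1 1 \<Omega> \<and> (\<forall>\<phi> \<in> W1_0 1 \<Omega>. p_area \<Omega> F H u \<le> p_area \<Omega> F H (\<lambda>x. u x + \<phi> x))"

section \<open>Differential forms and nonintegrability\<close>

text \<open>An alternating \<open>k\<close>-form on the vector space \<open>'v\<close> is represented as a real function of a
  sequence \<open>X\<close> of vectors which only depends on \<open>X 0, \<dots>, X (k - 1)\<close>. The degrees \<open>p\<close> and
  \<open>q\<close> of the factors are explicit arguments of the wedge product.\<close>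

type_synonym 'v form = "(nat \<Rightarrow> 'v) \<Rightarrow> real"

definition wedge :: "nat \<Rightarrow> nat \<Rightarrow> 'v form \<Rightarrow> 'v form \<Rightarrow> 'v form" where
  "wedge p q \<omega> \<eta> X =
    (\<Sum>\<sigma> | \<sigma> permutes {..<p + q}.
      of_int (sign \<sigma>) * \<omega> (\<lambda>i. X (\<sigma> i)) * \<eta> (\<lambda>i. X (\<sigma> (p + i)))) / (fact p * fact q)"

definition dx :: "'n \<Rightarrow> (real ^ 'n) form" where
  "dx i X = X 0 $ i"

text \<open>\<open>\<Theta>\<^sub>w = dw + \<Sum>\<^sub>I F\<^sub>I dx\<^sup>I\<close>.\<close>

definition Theta ::
  "(real ^ 'n::finite) set \<Rightarrow> (real ^ 'n \<Rightarrow> real ^ 'n) \<Rightarrow> (real ^ 'n \<Rightarrow> real) \<Rightarrow>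
    real ^ 'n \<Rightarrow> (real ^ 'n) form" where
  "Theta \<Omega> F w x X =
    (\<Sum>I\<in>UNIV. weak_deriv \<Omega> [I] w x * dx I X) + (\<Sum>I\<in>UNIV. F x $ I * dx I X)"

text \<open>\<open>d\<Theta>\<^sub>w = \<Sum>\<^sub>I\<^sub>,\<^sub>J \<partial>\<^sub>J F\<^sub>I dx\<^sup>J \<and> dx\<^sup>I\<close>. There is no dependence on \<open>w\<close>: the weak second
  derivatives of a twice weakly differentiable \<open>w\<close> are symmetric, so that \<open>ddw = 0\<close>.\<close>

definition dTheta ::
  "(real ^ 'n::finite) set \<Rightarrow> (real ^ 'n \<Rightarrow> real ^ 'n) \<Rightarrow> real ^ 'n \<Rightarrow> (real ^ 'n) form" where
  "dTheta \<Omega> F x X =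
    (\<Sum>I\<in>UNIV. \<Sum>J\<in>UNIV. weak_deriv \<Omega> [J] (\<lambda>y. F y $ I) x * wedge 1 1 (dx J) (dx I) X)"

definition nonintegrable ::
  "(real ^ 'n::finite) set \<Rightarrow> (real ^ 'n \<Rightarrow> real ^ 'n) \<Rightarrow> (real ^ 'n \<Rightarrow> real) \<Rightarrow> bool" where
  "nonintegrable \<Omega> F w \<longleftrightarrow>
    (AE x\<in>\<Omega> in lebesgue. wedge 1 2 (Theta \<Omega> F w x) (dTheta \<Omega> F x) \<noteq> (\<lambda>X. 0))"

end

theory Submission
  imports Defs
begin

text \<open>Put \<open>w = u - v\<close>, \<open>\<alpha> = \<nabla>u + F\<close> and \<open>\<beta> = \<nabla>v + F\<close>. The integrand of the generalized p-area is the norm of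
\<open>\<alpha>\<close> plus a term that is linear in \<open>u\<close>, so the functional is convex. The midpoint of \<open>u\<close> and \<open>v\<close> is an admissible
competitor for both minimizers; comparing its area with the mean of the two minimal ones forces equality in
\<open>|\<alpha> + \<beta>| \<le> |\<alpha>| + |\<beta>|\<close> almost everywhere, that is, \<open>\<alpha>\<close> and \<open>\<beta>\<close> have the same direction
(\<open>minimizers_same_direction\<close>). Since \<open>\<alpha>\<close> does not vanish, \<open>dw\<close> is a multiple of \<open>\<Theta>\<^sub>u\<close>, so
\<open>dw \<and> \<Theta>\<^sub>u = 0\<close>.

Let \<open>\<Theta>\<^sub>u\<close> be the nonintegrable form. Taking the exterior derivative of \<open>dw \<and> \<Theta>\<^sub>u = 0\<close> and using \<open>ddw = ddu = 0\<close> gives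
\<open>dw \<and> d\<Theta>\<^sub>u = 0\<close>. At a point with \<open>dw \<noteq> 0\<close> one has \<open>\<Theta>\<^sub>u = g dw\<close> for a number \<open>g\<close>, hence
\<open>\<Theta>\<^sub>u \<and> d\<Theta>\<^sub>u = 0\<close>, which nonintegrability excludes almost everywhere. Therefore \<open>dw = 0\<close> almost everywhere
(\<open>parallel_forms_gradient_zero\<close>), and the Poincare inequality for \<open>w\<close> in the closure of the test functions yields
\<open>w = 0\<close> (\<open>W1_0_zero_gradient\<close>).

The delicate step is the exterior derivative: the coefficients of \<open>dw\<close> and \<open>\<Theta>\<^sub>u\<close> and their weak derivatives are merely
locally integrable, so a product of two coefficients need not be locally integrable, let alone weakly differentiable.
What is needed is only that an identity \<open>a b = c d\<close> that holds almost everywhere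
may be differentiated formally (\<open>formal_product_rule\<close>), and this can be read off pointwise. The difference quotients of a
weakly differentiable function converge to the weak derivative locally in \<open>L\<^sup>1\<close>, hence almost everywhere along a
sequence of step lengths, and one sequence serves finitely many functions (\<open>difference_quotients_converge\<close>). For such a
sequence the difference quotients of the products converge pointwise by the elementary product rule.

The convergence of the difference quotients rests on three facts. The increment of a weakly differentiable function is
the integral of the weak derivative over a segment (\<open>weak_deriv_increment\<close>): this is the fundamental theorem of calculus for
test functions, transposed by Fubini. The passage from test functions to an almost everywhere statement is the
fundamental lemma of the calculus of variations. The averages over shrinking segments converge in the mean because translation
is continuous in \<open>L\<^sup>1\<close> (\<open>translation_L1\<close>).\<close>

section \<open>Partial derivatives and test functions\<close>

lemma partials_append: "partials (\<alpha> @ \<beta>) f = partials \<alpha> (partials \<beta> f)"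
  by (induction \<alpha>) auto

lemma smooth_partial: "smooth f \<Longrightarrow> smooth (partial i f)"
proof -
  assume "smooth f"
  moreover have "partials \<alpha> (partial i f) = partials (\<alpha> @ [i]) f" for \<alpha>
    by (simp add: partials_append)
  ultimately show ?thesis unfolding smooth_def by simp
qed

lemma smooth_partials: "smooth f \<Longrightarrow> smooth (partials \<alpha> f)"
  by (induction \<alpha>) (auto intro: smooth_partial)

lemma smooth_differentiable: "smooth f \<Longrightarrow> f differentiable (at x)"
  unfolding smooth_def using partials.simps(1)[of f] by (elim allE[of _ "[]"]) simp

lemma smooth_continuous: "smooth f \<Longrightarrow> continuous_on A f"
  by (meson continuous_at_imp_continuous_on differentiable_imp_continuous_within smooth_differentiable)

lemma differentiable_has_partial:
  assumes "f differentiable (at (x + t *\<^sub>R axis i 1))"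
  shows "((\<lambda>t. f (x + t *\<^sub>R axis i 1)) has_real_derivative partial i f (x + t *\<^sub>R axis i 1)) (at t)"
proof -
  let ?y = "x + t *\<^sub>R axis i 1"
  obtain D where D: "(f has_derivative D) (at ?y)"
    using assms unfolding differentiable_def by blast
  have "((\<lambda>s. f (?y + s *\<^sub>R axis i 1)) has_derivative (\<lambda>s. D (s *\<^sub>R axis i 1))) (at 0)"
    by (rule has_derivative_compose[of "\<lambda>s. ?y + s *\<^sub>R axis i 1" _ 0 UNIV f, simplified])
       (auto intro!: derivative_eq_intros simp: D)
  moreover have "(\<lambda>s. D (s *\<^sub>R axis i 1)) = (*) (D (axis i 1))"
    using linear_cmul[OF has_derivative_linear[OF D]] by (auto simp: fun_eq_iff)
  ultimately have d: "((\<lambda>s. f (?y + s *\<^sub>R axis i 1)) has_real_derivative D (axis i 1)) (at 0)"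
    by (simp add: has_field_derivative_def)
  then have "partial i f ?y = D (axis i 1)"
    unfolding partial_def by (rule DERIV_imp_deriv)
  moreover have "((\<lambda>s. f (x + s *\<^sub>R axis i 1)) has_real_derivative D (axis i 1)) (at t)"
    using d DERIV_shift[of "\<lambda>s. f (x + s *\<^sub>R axis i 1)" "D (axis i 1)" 0 t]
    by (simp add: algebra_simps)
  ultimately show ?thesis by simp
qed

lemma smooth_has_partial:
  assumes "smooth f"
  shows "((\<lambda>t. f (x + t *\<^sub>R axis i 1)) has_real_derivative partial i f (x + t *\<^sub>R axis i 1)) (at t)"
  by (rule differentiable_has_partial[OF smooth_differentiable[OF assms]])

text \<open>The mean value theorem is applied first in direction \<open>i\<close> to the increment in direction \<open>j\<close>, then in direction \<open>j\<close>. The left-hand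
side is symmetric in \<open>i\<close> and \<open>j\<close>, which yields the symmetry of second derivatives when \<open>t\<close> tends to 0.\<close>

lemma second_difference_mean_value:
  assumes f: "smooth f" and "t > 0"
  shows "\<exists>s s'. 0 < s \<and> s < t \<and> 0 < s' \<and> s' < t \<and>
    f (x + t *\<^sub>R axis i 1 + t *\<^sub>R axis j 1) - f (x + t *\<^sub>R axis i 1) - f (x + t *\<^sub>R axis j 1) + f x =
    t * t * partial j (partial i f) (x + s *\<^sub>R axis i 1 + s' *\<^sub>R axis j 1)"
proof -
  define g where "g s = f ((x + t *\<^sub>R axis j 1) + s *\<^sub>R axis i 1) - f (x + s *\<^sub>R axis i 1)" for s
  have "DERIV g s :> partial i f ((x + t *\<^sub>R axis j 1) + s *\<^sub>R axis i 1) - partial i f (x + s *\<^sub>R axis i 1)" for s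
    unfolding g_def by (intro DERIV_diff smooth_has_partial f)
  from MVT2[OF \<open>t > 0\<close> this] obtain s where s: "0 < s" "s < t"
    "g t - g 0 = t * (partial i f ((x + t *\<^sub>R axis j 1) + s *\<^sub>R axis i 1) - partial i f (x + s *\<^sub>R axis i 1))"
    by auto
  have "DERIV (\<lambda>r. partial i f ((x + s *\<^sub>R axis i 1) + r *\<^sub>R axis j 1)) r :>
      partial j (partial i f) ((x + s *\<^sub>R axis i 1) + r *\<^sub>R axis j 1)" for r
    by (intro smooth_has_partial smooth_partial f)
  from MVT2[OF \<open>t > 0\<close> this] obtain r where r: "0 < r" "r < t"
    "partial i f ((x + s *\<^sub>R axis i 1) + t *\<^sub>R axis j 1) - partial i f (x + s *\<^sub>R axis i 1)
      = t * partial j (partial i f) ((x + s *\<^sub>R axis i 1) + r *\<^sub>R axis j 1)"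
    by auto
  show ?thesis
    apply (rule exI[of _ s], rule exI[of _ r])
    using s r by (simp add: g_def algebra_simps)
qed

lemma smooth_partial_commute:
  assumes f: "smooth f"
  shows "partial i (partial j f) = partial j (partial i f)"
proof
  fix x
  have *: "(\<lambda>n. (f (x + T n *\<^sub>R axis i 1 + T n *\<^sub>R axis j 1) - f (x + T n *\<^sub>R axis i 1)
      - f (x + T n *\<^sub>R axis j 1) + f x) / (T n * T n)) \<longlonglongrightarrow> partial j (partial i f) x"
    if T: "T = (\<lambda>n. inverse (real (Suc n)))" for T i j
  proof -
    have "T n > 0" for n by (simp add: T)
    from second_difference_mean_value[OF f this, of _ x i j]
    obtain s s' where s: "\<And>n. 0 < s n" "\<And>n. s n < T n" "\<And>n. 0 < s' n" "\<And>n. s' n < T n"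
      and e: "\<And>n. f (x + T n *\<^sub>R axis i 1 + T n *\<^sub>R axis j 1) - f (x + T n *\<^sub>R axis i 1)
      - f (x + T n *\<^sub>R axis j 1) + f x
       = T n * T n * partial j (partial i f) (x + s n *\<^sub>R axis i 1 + s' n *\<^sub>R axis j 1)"
      by metis
    have T0: "T \<longlonglongrightarrow> 0" unfolding T by (rule LIMSEQ_inverse_real_of_nat)
    have s0: "s \<longlonglongrightarrow> 0" by (rule tendsto_sandwich[OF _ _ tendsto_const T0]) (auto intro: always_eventually less_imp_le s)
    have s0': "s' \<longlonglongrightarrow> 0" by (rule tendsto_sandwich[OF _ _ tendsto_const T0]) (auto intro: always_eventually less_imp_le s)
    have "(\<lambda>n. x + s n *\<^sub>R axis i 1 + s' n *\<^sub>R axis j 1) \<longlonglongrightarrow> x + 0 *\<^sub>R axis i 1 + 0 *\<^sub>R axis j 1"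
      by (intro tendsto_intros s0 s0')
    then have l: "(\<lambda>n. x + s n *\<^sub>R axis i 1 + s' n *\<^sub>R axis j 1) \<longlonglongrightarrow> x" by simp
    have "isCont (partial j (partial i f)) x"
      using smooth_differentiable[OF smooth_partial[OF smooth_partial[OF f]]]
        differentiable_imp_continuous_within by blast
    from isCont_tendsto_compose[OF this l]
    show ?thesis using \<open>\<And>n. T n > 0\<close> by (simp add: e less_imp_neq[symmetric])
  qed
  define T where "T = (\<lambda>n. inverse (real (Suc n)))"
  from *[OF T_def, of i j] *[OF T_def, of j i]
  show "partial i (partial j f) x = partial j (partial i f) x"
    by (intro LIMSEQ_unique) (auto simp: algebra_simps)
qed

lemma partial_eq_0_outside:
  assumes "x \<notin> closure {x. f x \<noteq> 0}"
  shows "partial i f x = 0"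
proof -
  have "open (- closure {x. f x \<noteq> 0})" by auto
  then obtain e where e: "e > 0" "ball x e \<subseteq> - closure {x. f x \<noteq> 0}"
    using assms openE by blast
  have "\<forall>\<^sub>F t in nhds 0. f (x + t *\<^sub>R axis i 1) = 0"
    unfolding eventually_nhds_metric
  proof (intro exI[of _ e] conjI allI impI)
    fix t :: real assume "dist t 0 < e"
    then have "x + t *\<^sub>R axis i 1 \<in> ball x e" by (simp add: dist_norm)
    then have "x + t *\<^sub>R axis i 1 \<in> - closure {x. f x \<noteq> 0}" using e by blast
    then show "f (x + t *\<^sub>R axis i 1) = 0" using closure_subset[of "{x. f x \<noteq> 0}"] by blast
  qed (use e in auto)
  then have "deriv (\<lambda>t. f (x + t *\<^sub>R axis i 1)) 0 = deriv (\<lambda>t. 0) 0"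
    by (rule deriv_cong_ev) simp
  then show ?thesis by (simp add: partial_def)
qed

lemma partial_support:
  "closure {x. partial i f x \<noteq> 0} \<subseteq> closure {x. f x \<noteq> 0}"
  using partial_eq_0_outside by (intro closure_minimal) auto

lemma compact_closure_subset:
  fixes A :: "'a::euclidean_space set"
  shows "compact (closure B) \<Longrightarrow> A \<subseteq> closure B \<Longrightarrow> compact (closure A)"
  by (meson bounded_subset compact_closure compact_imp_bounded)

lemma test_function_partial:
  assumes "\<phi> \<in> test_functions \<Omega>" shows "partial i \<phi> \<in> test_functions \<Omega>"
proof -
  have "{x. partial i \<phi> x \<noteq> 0} \<subseteq> closure {x. \<phi> x \<noteq> 0}"
    using partial_eq_0_outside by auto
  then show ?thesis
    using assms partial_support[of i \<phi>] compact_closure_subset[of "{x. \<phi> x \<noteq> 0}"]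
    unfolding test_functions_def mem_Collect_eq by (blast intro: smooth_partial)
qed

lemma test_function_mono:
  "\<phi> \<in> test_functions A \<Longrightarrow> A \<subseteq> B \<Longrightarrow> \<phi> \<in> test_functions B"
  unfolding test_functions_def by auto

lemma partial_shift: "partial i (\<lambda>x. f (x + a)) = (\<lambda>x. partial i f (x + a))"
  unfolding partial_def by (simp add: algebra_simps)

lemma partials_shift: "partials \<alpha> (\<lambda>x. f (x + a)) = (\<lambda>x. partials \<alpha> f (x + a))"
  by (induction \<alpha>) (auto simp: partial_shift)

lemma smooth_shift: "smooth f \<Longrightarrow> smooth (\<lambda>x. f (x + a))"
  unfolding smooth_def partials_shift
proof (intro allI)
  fix \<alpha> x assume "\<forall>\<alpha> x. partials \<alpha> f differentiable (at x)"
  then have "(partials \<alpha> f \<circ> (\<lambda>x. x + a)) differentiable (at x)"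
    by (intro differentiable_chain_at) auto
  then show "(\<lambda>x. partials \<alpha> f (x + a)) differentiable (at x)" by (simp add: o_def)
qed

lemma support_shift:
  fixes a :: "real^'n::finite"
  shows "closure {x. f (x + a) \<noteq> 0} = (\<lambda>x. x - a) ` closure {x. f x \<noteq> (0::real)}"
proof -
  have "{x. f (x + a) \<noteq> 0} = (\<lambda>x. - a + x) ` {x. f x \<noteq> 0}"
    by (auto simp: image_iff) (metis add.commute add_diff_cancel_right')
  then show ?thesis using closure_translation[of "- a" "{x. f x \<noteq> 0}"] by (simp add: algebra_simps)
qed

lemma test_function_shift:
  assumes "\<phi> \<in> test_functions \<Omega>"
  shows "(\<lambda>x. \<phi> (x + a)) \<in> test_functions ((\<lambda>x. x - a) ` \<Omega>)"
proof -
  have "compact ((\<lambda>x. x - a) ` closure {x. \<phi> x \<noteq> 0})"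
    using assms unfolding test_functions_def by (auto intro: compact_translation_subtract)
  then show ?thesis
    using assms unfolding test_functions_def mem_Collect_eq support_shift by (auto intro: smooth_shift)
qed

lemma smooth_partial_scale:
  assumes "smooth f" shows "partial i (\<lambda>x. c * f x) = (\<lambda>x. c * partial i f x)"
proof
  fix x
  have "((\<lambda>t. c * f (x + t *\<^sub>R axis i 1)) has_real_derivative c * partial i f x) (at 0)"
    using DERIV_cmult[OF smooth_has_partial[OF assms, of x i 0], of c] by simp
  then show "partial i (\<lambda>x. c * f x) x = c * partial i f x"
    unfolding partial_def by (rule DERIV_imp_deriv)
qed

lemma smooth_partials_scale: "smooth f \<Longrightarrow> partials \<alpha> (\<lambda>x. c * f x) = (\<lambda>x. c * partials \<alpha> f x)"
  by (induction \<alpha>) (auto simp: smooth_partial_scale smooth_partials)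

lemma smooth_scale: "smooth f \<Longrightarrow> smooth (\<lambda>x. c * f x)"
  unfolding smooth_def[of "\<lambda>x. c * f x"] 
  by (auto simp: smooth_partials_scale intro!: derivative_intros smooth_differentiable smooth_partials)

lemma test_function_scale: 
  assumes "\<phi> \<in> test_functions \<Omega>" shows "(\<lambda>x. c * \<phi> x) \<in> test_functions \<Omega>"
proof -
  have "closure {x. c * \<phi> x \<noteq> 0} \<subseteq> closure {x. \<phi> x \<noteq> 0}"
    by (intro closure_mono) auto
  then show ?thesis using assms unfolding test_functions_def
    by (auto intro: smooth_scale simp: compact_eq_bounded_closed bounded_subset)
qed


lemma test_function_continuous: "\<phi> \<in> test_functions \<Omega> \<Longrightarrow> continuous_on A \<phi>"
  unfolding test_functions_def by (auto intro: smooth_continuous)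

lemma test_function_measurable: "\<phi> \<in> test_functions \<Omega> \<Longrightarrow> \<phi> \<in> borel_measurable borel"
  by (intro borel_measurable_continuous_onI test_function_continuous)

lemma test_function_integrable:
  assumes "\<phi> \<in> test_functions \<Omega>" shows "integrable lborel \<phi>"
proof -
  let ?S = "closure {x. \<phi> x \<noteq> 0}"
  have "integrable lborel (\<lambda>x. indicator ?S x *\<^sub>R \<phi> x)"
    using assms by (intro borel_integrable_compact test_function_continuous) (auto simp: test_functions_def)
  moreover have "(\<lambda>x. indicator ?S x *\<^sub>R \<phi> x) = \<phi>"
    using closure_subset[of "{x. \<phi> x \<noteq> 0}"] by (auto simp: fun_eq_iff indicator_def)
  ultimately show ?thesis by simp
qed

lemma test_function_bounded:
  assumes "\<phi> \<in> test_functions \<Omega>" obtains B where "\<And>x. \<bar>\<phi> x\<bar> \<le> B"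
proof -
  let ?S = "closure {x. \<phi> x \<noteq> 0}"
  have "compact (\<phi> ` ?S)"
    using assms by (intro compact_continuous_image test_function_continuous) (auto simp: test_functions_def)
  then obtain B where B: "\<And>x. x \<in> ?S \<Longrightarrow> \<bar>\<phi> x\<bar> \<le> B"
    using compact_imp_bounded bounded_iff by (metis imageI real_norm_def)
  have "\<bar>\<phi> x\<bar> \<le> max B 0" for x
    using B[of x] closure_subset[of "{x. \<phi> x \<noteq> 0}"] by (cases "\<phi> x = 0") auto
  then show ?thesis using that by blast
qed

text \<open>The segment is parametrized over the unit interval for every step length \<open>t\<close>, of either sign, so that in Fubini arguments the
domain of the parameter does not depend on \<open>t\<close>.\<close>

lemma increment_formula:
  assumes d: "\<And>x. f differentiable (at x)" and c: "continuous_on UNIV (partial i f)"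
  shows "f (x + t *\<^sub>R axis i 1) - f x =
    (\<integral>s. indicator {0..1} s * (t * partial i f (x + s *\<^sub>R (t *\<^sub>R axis i 1))) \<partial>lborel)"
proof -
  have "((\<lambda>s. f (x + (s * t) *\<^sub>R axis i 1)) has_real_derivative
      t * partial i f (x + (s * t) *\<^sub>R axis i 1)) (at s)" for s
  proof -
    have "((\<lambda>s. s * t) has_real_derivative t) (at s)" by (auto intro!: derivative_eq_intros)
    from DERIV_chain2[OF differentiable_has_partial[OF d] this, of x i] show ?thesis by (simp add: mult.commute)
  qed
  moreover have "isCont (\<lambda>s. t * partial i f (x + (s * t) *\<^sub>R axis i 1)) s" for s
  proof -
    have "continuous_on UNIV (\<lambda>s. t * partial i f (x + (s * t) *\<^sub>R axis i 1))"
      by (intro continuous_intros continuous_on_compose2[OF c]) auto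
    then show ?thesis by (simp add: continuous_on_eq_continuous_at)
  qed
  ultimately show ?thesis
    using integral_FTC_Icc_real[of 0 1 "\<lambda>s. f (x + (s * t) *\<^sub>R axis i 1)"
      "\<lambda>s. t * partial i f (x + (s * t) *\<^sub>R axis i 1)"] by (auto simp: mult.commute mult.left_commute)
qed

lemma integrable_times_test_function:
  assumes q: "integrable lborel q" and p: "\<phi> \<in> test_functions \<Omega>"
  shows "integrable lborel (\<lambda>x. q x * \<phi> x)"
proof -
  obtain B where B: "\<And>x. \<bar>\<phi> x\<bar> \<le> B" using test_function_bounded[OF p] by blast
  show ?thesis
  proof (rule Bochner_Integration.integrable_bound[of _ "\<lambda>x. B * q x"])
    show "integrable lborel (\<lambda>x. B * q x)" using q by simp
    show "(\<lambda>x. q x * \<phi> x) \<in> borel_measurable lborel"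
      using q test_function_measurable[OF p] by simp
    show "AE x in lborel. norm (q x * \<phi> x) \<le> norm (B * q x)"
      using mult_left_mono[OF order_trans[OF B abs_ge_self], of "\<bar>q _\<bar>"]
      by (intro AE_I2) (simp add: abs_mult mult.commute)
  qed
qed

lemma test_function_set_integrable:
  assumes p: "\<phi> \<in> test_functions \<Omega>" and A: "A \<in> sets lebesgue"
  shows "set_integrable lebesgue A \<phi>"
proof -
  have "integrable lebesgue \<phi>"
    using test_function_integrable[OF p] test_function_measurable[OF p] by (simp add: integrable_completion)
  with A show ?thesis unfolding set_integrable_def by (rule integrable_mult_indicator)
qed

lemma test_function_increment:
  assumes "\<phi> \<in> test_functions \<Omega>"
  shows "\<phi> (x + t *\<^sub>R axis i 1) - \<phi> x =
    (\<integral>s. indicator {0..1} s * (t * partial i \<phi> (x + s *\<^sub>R (t *\<^sub>R axis i 1))) \<partial>lborel)"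
  using assms by (intro increment_formula)
    (auto simp: test_functions_def intro: smooth_differentiable smooth_continuous smooth_partial)

section \<open>Bump functions\<close>

text \<open>For \<open>P = 1\<close> this is the standard smooth function that vanishes to infinite order at 0. The factor \<open>P\<close> makes the
family closed under differentiation.\<close>

definition flat :: "real poly \<Rightarrow> real \<Rightarrow> real" where
  "flat P t = (if t > 0 then poly P (1 / t) * exp (- (1 / t)) else 0)"

lemma poly_times_exp_tendsto_0: "((\<lambda>x::real. poly P x * exp (- x)) \<longlongrightarrow> 0) at_top"
proof -
  have "((\<lambda>x::real. \<Sum>i\<le>degree P. coeff P i * (x ^ i / exp x)) \<longlongrightarrow> (\<Sum>i\<le>degree P. coeff P i * 0)) at_top"
    by (intro tendsto_intros tendsto_power_div_exp_0)
  then show ?thesis by (simp add: poly_altdef sum_distrib_right exp_minus divide_inverse mult.assoc)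
qed

lemma flat_deriv: "(flat P has_real_derivative flat ([:0, 0, 1:] * (P - pderiv P)) t) (at t)"
proof -
  consider "t > 0" | "t < 0" | "t = 0" by linarith
  then show ?thesis
  proof cases
    case 1
    have "((\<lambda>t. poly P (1 / t) * exp (- (1 / t))) has_real_derivative flat ([:0, 0, 1:] * (P - pderiv P)) t) (at t)"
      using 1 by (auto intro!: derivative_eq_intros DERIV_chain2[OF poly_DERIV]
          simp: flat_def field_simps power2_eq_square)
    then show ?thesis
      by (rule has_field_derivative_transform_within_open[of _ _ _ "{0<..}"]) (use 1 in \<open>auto simp: flat_def\<close>)
  next
    case 2
    have "((\<lambda>t. 0) has_real_derivative flat ([:0, 0, 1:] * (P - pderiv P)) t) (at t)"
      using 2 by (simp add: flat_def)
    then show ?thesis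
      by (rule has_field_derivative_transform_within_open[of _ _ _ "{..<0}"]) (use 2 in \<open>auto simp: flat_def\<close>)
  next
    case 3
    have r: "((\<lambda>h. flat P h / h) \<longlongrightarrow> 0) (at_right 0)"
    proof -
      have "((\<lambda>h. poly ([:0, 1:] * P) (inverse h) * exp (- (inverse h))) \<longlongrightarrow> 0) (at_right 0)"
        by (rule filterlim_compose[OF poly_times_exp_tendsto_0 filterlim_inverse_at_top_right])
      then show ?thesis
        by (rule Lim_transform_eventually)
           (auto simp: eventually_at_right_less flat_def field_simps intro!: eventually_mono[OF eventually_at_right_less])
    qed
    have l: "((\<lambda>h. flat P h / h) \<longlongrightarrow> 0) (at_left 0)"
      by (rule Lim_transform_eventually[OF tendsto_const])
         (auto simp: flat_def eventually_at_filter)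
    have "((\<lambda>h. flat P h / h) \<longlongrightarrow> 0) (at 0)" using l r by (rule filterlim_split_at)
    then show ?thesis using 3 by (simp add: DERIV_def flat_def)
  qed
qed

text \<open>The definition of smoothness speaks of all iterated partial derivatives. It is checked through an algebra of functions, built from
the family above, that consists of differentiable functions and is closed under partial derivatives.\<close>

inductive_set flat_algebra :: "(real ^ 'n::finite \<Rightarrow> real) set" where
  base: "(\<lambda>x. flat P (c + s * x $ i)) \<in> flat_algebra"
| const: "(\<lambda>x. c) \<in> flat_algebra"
| add: "f \<in> flat_algebra \<Longrightarrow> g \<in> flat_algebra \<Longrightarrow> (\<lambda>x. f x + g x) \<in> flat_algebra"
| mult: "f \<in> flat_algebra \<Longrightarrow> g \<in> flat_algebra \<Longrightarrow> (\<lambda>x. f x * g x) \<in> flat_algebra"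

lemma partial_eqI:
  "(\<And>x. ((\<lambda>t. f (x + t *\<^sub>R axis k 1)) has_real_derivative g x) (at 0)) \<Longrightarrow> partial k f = g"
  unfolding partial_def by (auto intro!: ext DERIV_imp_deriv)

lemma flat_algebra_closed:
  fixes f :: "real ^ 'n::finite \<Rightarrow> real"
  assumes "f \<in> flat_algebra"
  shows "(\<forall>x. f differentiable (at x)) \<and> (\<forall>k. partial k f \<in> flat_algebra)"
  using assms
proof induction
  case (base P c s i)
  let ?Q = "[:0, 0, 1:] * (P - pderiv P)"
  have "((\<lambda>x. flat P (c + s * x $ i)) has_derivative (\<lambda>h. flat ?Q (c + s * x $ i) * (s * h $ i))) (at x)" for x
    by (rule has_derivative_compose[OF _ flat_deriv[unfolded has_field_derivative_def], of "\<lambda>x. c + s * x $ i" "\<lambda>h. s * h $ i"])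
       (auto intro!: derivative_eq_intros bounded_linear_imp_has_derivative bounded_linear_vec_nth)
  then have "(\<lambda>x. flat P (c + s * x $ i)) differentiable (at x)" for x
    unfolding differentiable_def by blast
  moreover have "partial k (\<lambda>x. flat P (c + s * x $ i)) = (\<lambda>x. (if k = i then s else 0) * flat ?Q (c + s * x $ i))" for k
  proof (rule partial_eqI)
    fix x
    have *: "((\<lambda>t. c + s * (x + t *\<^sub>R axis k 1) $ i) has_real_derivative (if k = i then s else 0)) (at 0)"
      by (auto intro!: derivative_eq_intros simp: axis_def)
    show "((\<lambda>t. flat P (c + s * (x + t *\<^sub>R axis k 1) $ i)) has_real_derivative
        (if k = i then s else 0) * flat ?Q (c + s * x $ i)) (at 0)"
      using DERIV_chain2[OF flat_deriv * ] by (simp add: mult.commute)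
  qed
  moreover have "(\<lambda>x. (if k = i then s else 0) * flat ?Q (c + s * x $ i)) \<in> flat_algebra" for k
    by (intro flat_algebra.intros)
  ultimately show ?case by simp
next
  case (const c)
  have "partial k (\<lambda>x :: real ^ 'n. c) = (\<lambda>x. 0)" for k
    by (rule partial_eqI) auto
  then show ?case by (simp add: flat_algebra.const)
next
  case (add f g)
  have "partial k (\<lambda>x. f x + g x) = (\<lambda>x. partial k f x + partial k g x)" for k
    using add.IH differentiable_has_partial[of f _ 0 k] differentiable_has_partial[of g _ 0 k]
    by (intro partial_eqI DERIV_add) auto
  then show ?case using add.IH by (auto intro: flat_algebra.intros)
next
  case (mult f g)
  have "partial k (\<lambda>x. f x * g x) = (\<lambda>x. partial k f x * g x + partial k g x * f x)" for k
    using mult.IH differentiable_has_partial[of f _ 0 k] differentiable_has_partial[of g _ 0 k]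
    by (intro partial_eqI) (auto intro!: derivative_eq_intros)
  then show ?case using mult by (auto intro!: flat_algebra.intros)
qed

lemma flat_algebra_smooth: "f \<in> flat_algebra \<Longrightarrow> smooth f"
proof -
  assume f: "f \<in> flat_algebra"
  have "partials \<alpha> f \<in> flat_algebra" for \<alpha>
    by (induction \<alpha>) (use f flat_algebra_closed in auto)
  then show ?thesis unfolding smooth_def using flat_algebra_closed by blast
qed

lemma flat_algebra_prod:
  "finite A \<Longrightarrow> (\<And>i. i \<in> A \<Longrightarrow> f i \<in> flat_algebra) \<Longrightarrow> (\<lambda>x. \<Prod>i\<in>A. f i x) \<in> flat_algebra"
  by (induction rule: finite_induct) (auto intro: flat_algebra.intros)

text \<open>A scaling by \<open>n + 1\<close> before the application of \<open>exp (- 1 / t)\<close> drives each factor to 1 inside the box without enlarging the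
support, so these test functions increase to the indicator of the open box.\<close>

definition bump :: "real ^ 'n::finite \<Rightarrow> real ^ 'n \<Rightarrow> nat \<Rightarrow> real ^ 'n \<Rightarrow> real" where
  "bump a b n x = (\<Prod>i\<in>UNIV. flat 1 (real (Suc n) * (x $ i - a $ i)) * flat 1 (real (Suc n) * (b $ i - x $ i)))"

lemma flat_1_bounds: "0 \<le> flat 1 t" "flat 1 t \<le> 1"
  by (auto simp: flat_def)

lemma bump_support:
  assumes "x \<notin> box a b" shows "bump a b n x = 0"
proof -
  obtain i where "x $ i - a $ i \<le> 0 \<or> b $ i - x $ i \<le> 0"
    using assms by (auto simp: mem_box_cart not_less)
  then have "flat 1 (real (Suc n) * (x $ i - a $ i)) * flat 1 (real (Suc n) * (b $ i - x $ i)) = 0"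
    by (auto simp: flat_def zero_less_mult_iff)
  then show ?thesis unfolding bump_def by (intro prod_zero) auto
qed

lemma bump_abs_le_1: "\<bar>bump a b n x\<bar> \<le> 1"
  unfolding bump_def abs_prod
  by (rule prod_le_1) (auto simp: abs_mult flat_1_bounds intro!: mult_le_one)

lemma bump_tendsto: "(\<lambda>n. bump a b n x) \<longlonglongrightarrow> indicator (box a b) x"
proof (cases "x \<in> box a b")
  case True
  have "(\<lambda>n. flat 1 (real (Suc n) * t)) \<longlonglongrightarrow> 1" if "t > 0" for t
  proof -
    have "(\<lambda>n. exp (- (inverse (real (Suc n)) * (1 / t)))) \<longlonglongrightarrow> exp (- (0 * (1 / t)))"
      by (intro tendsto_intros LIMSEQ_inverse_real_of_nat)
    moreover have "flat 1 (real (Suc n) * t) = exp (- (inverse (real (Suc n)) * (1 / t)))" for n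
      using mult_pos_pos[of "real (Suc n)" t] that by (simp add: flat_def inverse_eq_divide del: of_nat_Suc)
    ultimately show ?thesis by simp
  qed
  then have "(\<lambda>n. bump a b n x) \<longlonglongrightarrow> (\<Prod>i\<in>(UNIV::'a set). 1 * 1)"
    unfolding bump_def using True by (intro tendsto_intros) (auto simp: mem_box_cart)
  then show ?thesis using True by simp
next
  case False
  then show ?thesis by (simp add: bump_support)
qed

lemma bump_test_function:
  assumes "cbox a b \<subseteq> \<Omega>" shows "bump a b n \<in> test_functions \<Omega>"
proof -
  have "(\<lambda>x. flat 1 (- (real (Suc n) * a $ i) + real (Suc n) * x $ i) *
      flat 1 (real (Suc n) * b $ i + - real (Suc n) * x $ i)) \<in> flat_algebra" for i
    by (intro flat_algebra.intros)
  then have "(\<lambda>x. \<Prod>i\<in>UNIV. flat 1 (- (real (Suc n) * a $ i) + real (Suc n) * x $ i) *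
      flat 1 (real (Suc n) * b $ i + - real (Suc n) * x $ i)) \<in> flat_algebra"
    by (intro flat_algebra_prod) auto
  moreover have "(\<lambda>x. \<Prod>i\<in>UNIV. flat 1 (- (real (Suc n) * a $ i) + real (Suc n) * x $ i) *
      flat 1 (real (Suc n) * b $ i + - real (Suc n) * x $ i)) = bump a b n"
    unfolding bump_def by (intro ext prod.cong refl arg_cong2[where f="(*)"] arg_cong[where f="flat 1"]) (simp_all add: algebra_simps)
  ultimately have "smooth (bump a b n)" by (metis flat_algebra_smooth)
  moreover have "closure {x. bump a b n x \<noteq> 0} \<subseteq> cbox a b"
    using bump_support[of _ a b n] box_subset_cbox[of a b] by (intro closure_minimal) auto
  ultimately show ?thesis
    using assms unfolding test_functions_def
    by (auto simp del: compact_closure simp: compact_eq_bounded_closed intro: bounded_subset[OF bounded_cbox])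
qed

section \<open>Integration and translation\<close>

lemma AE_locally:
  fixes \<Omega> :: "'a::second_countable_topology set"
  assumes "\<And>x. x \<in> \<Omega> \<Longrightarrow> \<exists>U. open U \<and> x \<in> U \<and> (AE y in M. y \<in> U \<longrightarrow> P y)"
  shows "AE y in M. y \<in> \<Omega> \<longrightarrow> P y"
proof -
  define \<F> where "\<F> = {U. open U \<and> (AE y in M. y \<in> U \<longrightarrow> P y)}"
  obtain \<G> where G: "\<G> \<subseteq> \<F>" "countable \<G>" "\<Union>\<G> = \<Union>\<F>"
    using Lindelof[of \<F>] unfolding \<F>_def by auto
  have ae: "AE y in M. \<forall>U\<in>\<G>. y \<in> U \<longrightarrow> P y"
    using G by (subst AE_ball_countable) (auto simp: \<F>_def)
  have "\<Omega> \<subseteq> \<Union>\<G>"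
    unfolding G(3) using assms by (force simp: \<F>_def)
  then show ?thesis by (intro eventually_mono[OF ae]) blast
qed

lemma lborel_integral_shift:
  fixes f :: "'a::euclidean_space \<Rightarrow> real"
  assumes [measurable]: "f \<in> borel_measurable borel"
  shows "(\<integral>x. f (x + v) \<partial>lborel) = (\<integral>x. f x \<partial>lborel)"
  by (subst (2) lborel_distr_plus[of v, symmetric], subst integral_distr) (auto simp: add.commute)

lemma lborel_integrable_shift:
  fixes f :: "'a::euclidean_space \<Rightarrow> real"
  assumes "integrable lborel f"
  shows "integrable lborel (\<lambda>x. f (x + v))"
proof -
  have [measurable]: "f \<in> borel_measurable borel" using assms by auto
  have "integrable (distr lborel borel ((+) v)) f" using assms by (simp add: lborel_distr_plus)
  then show ?thesis by (subst (asm) integrable_distr_eq) (auto simp: add.commute)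
qed

lemma lborel_nn_integral_shift:
  fixes f :: "'a::euclidean_space \<Rightarrow> ennreal"
  assumes [measurable]: "f \<in> borel_measurable borel"
  shows "(\<integral>\<^sup>+x. f (x + v) \<partial>lborel) = (\<integral>\<^sup>+x. f x \<partial>lborel)"
  by (subst (2) lborel_distr_plus[of v, symmetric], subst nn_integral_distr) (auto simp: add.commute)

lemma lborel_AE_shift:
  fixes v :: "'a::euclidean_space"
  assumes "AE x in lborel. P x"
  shows "AE x in lborel. P (x + v)"
proof -
  obtain N where N: "{x. \<not> P x} \<subseteq> N" "N \<in> sets borel" "emeasure lborel N = 0"
    using assms by (auto elim!: AE_E)
  have m: "(\<lambda>x. x + v) \<in> borel_measurable borel" by simp
  have "(\<lambda>x. x + v) -` N \<in> sets borel"
    using measurable_sets[OF m N(2)] by simp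
  moreover have "emeasure lborel ((\<lambda>x. x + v) -` N) = 0"
  proof -
    have eq: "(\<lambda>x. x + v) = (+) v" by (auto simp: add.commute)
    show ?thesis
      unfolding eq using N arg_cong[OF lborel_distr_plus[of v], of "\<lambda>M. emeasure M N"]
      by (subst (asm) emeasure_distr) auto
  qed
  ultimately show ?thesis
    using N(1) by (intro AE_I[of _ _ "(\<lambda>x. x + v) -` N"]) auto
qed

text \<open>Continuity of translation in the mean passes to limits in \<open>L\<^sup>1\<close>: translation is an isometry, so an approximation
error of \<open>g\<close> enters twice, independently of the translation.\<close>

lemma translation_L1_closed:
  fixes f :: "'a::euclidean_space \<Rightarrow> real" and v :: "nat \<Rightarrow> 'a"
  assumes f: "integrable lborel f"
    and ap: "\<And>\<epsilon>. \<epsilon> > 0 \<Longrightarrow> \<exists>g. integrable lborel g \<and> (\<integral>x. \<bar>f x - g x\<bar> \<partial>lborel) \<le> \<epsilon> \<and>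
      (\<lambda>n. \<integral>x. \<bar>g (x + v n) - g x\<bar> \<partial>lborel) \<longlonglongrightarrow> 0"
  shows "(\<lambda>n. \<integral>x. \<bar>f (x + v n) - f x\<bar> \<partial>lborel) \<longlonglongrightarrow> 0"
proof (rule LIMSEQ_I)
  fix \<epsilon> :: real assume "\<epsilon> > 0"
  then obtain g where g: "integrable lborel g" "(\<integral>x. \<bar>f x - g x\<bar> \<partial>lborel) \<le> \<epsilon> / 4"
    and l: "(\<lambda>n. \<integral>x. \<bar>g (x + v n) - g x\<bar> \<partial>lborel) \<longlonglongrightarrow> 0"
    using ap[of "\<epsilon> / 4"] by auto
  have [measurable]: "f \<in> borel_measurable borel" "g \<in> borel_measurable borel" using f g by auto
  obtain N where N: "\<And>n. n \<ge> N \<Longrightarrow> (\<integral>x. \<bar>g (x + v n) - g x\<bar> \<partial>lborel) < \<epsilon> / 4"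
    using LIMSEQ_D[OF l, of "\<epsilon> / 4"] \<open>\<epsilon> > 0\<close> by auto
  have "(\<integral>x. \<bar>f (x + v n) - f x\<bar> \<partial>lborel) < \<epsilon>" if "n \<ge> N" for n
  proof -
    note i = f g(1) lborel_integrable_shift[OF f, of "v n"] lborel_integrable_shift[OF g(1), of "v n"]
    have fg: "integrable lborel (\<lambda>x. \<bar>f x - g x\<bar>)" using i by auto
    have "(\<integral>x. \<bar>f (x + v n) - f x\<bar> \<partial>lborel) \<le>
      (\<integral>x. \<bar>f (x + v n) - g (x + v n)\<bar> + (\<bar>g (x + v n) - g x\<bar> + \<bar>f x - g x\<bar>) \<partial>lborel)"
      using i by (intro integral_mono Bochner_Integration.integrable_add integrable_abs
          Bochner_Integration.integrable_diff) auto
    also have "\<dots> = (\<integral>x. \<bar>f (x + v n) - g (x + v n)\<bar> \<partial>lborel) + ((\<integral>x. \<bar>g (x + v n) - g x\<bar> \<partial>lborel)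
        + (\<integral>x. \<bar>f x - g x\<bar> \<partial>lborel))"
      using i by (subst Bochner_Integration.integral_add integrable_abs; auto)+
    also have "(\<integral>x. \<bar>f (x + v n) - g (x + v n)\<bar> \<partial>lborel) = (\<integral>x. \<bar>f x - g x\<bar> \<partial>lborel)"
      by (rule lborel_integral_shift[of "\<lambda>x. \<bar>f x - g x\<bar>"]) simp
    finally show ?thesis using N[OF that] g(2) \<open>\<epsilon> > 0\<close> by linarith
  qed
  then show "\<exists>N. \<forall>n\<ge>N. norm ((\<integral>x. \<bar>f (x + v n) - f x\<bar> \<partial>lborel) - 0) < \<epsilon>"
    by (intro exI[of _ N]) auto
qed

text \<open>For an open set the part of \<open>U\<close> that a small translation moves out of \<open>U\<close> is negligible by dominated convergence. The part that
moves in has the same measure, as the total measure is preserved; hence the factor 2.\<close>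

lemma translation_L1_open:
  fixes U :: "'a::euclidean_space set"
  assumes U: "open U" "emeasure lborel U < \<infinity>" and v: "v \<longlonglongrightarrow> 0"
  shows "(\<lambda>n. \<integral>x. \<bar>indicator U (x + v n) - (indicator U x :: real)\<bar> \<partial>lborel) \<longlonglongrightarrow> 0"
proof -
  have i: "integrable lborel (indicator U :: 'a \<Rightarrow> real)" using U by simp
  have m[measurable]: "U \<in> sets borel" using U by simp
  have "(\<lambda>n. \<integral>x. indicator U x * (1 - indicator U (x + v n) :: real) \<partial>lborel) \<longlonglongrightarrow> (\<integral>x. 0 \<partial>(lborel :: 'a measure))"
  proof (rule integral_dominated_convergence[where w = "indicator U"])
    show "AE x in lborel. (\<lambda>n. indicator U x * (1 - indicator U (x + v n) :: real)) \<longlonglongrightarrow> 0"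
    proof (rule AE_I2)
      fix x :: 'a
      show "(\<lambda>n. indicator U x * (1 - indicator U (x + v n) :: real)) \<longlonglongrightarrow> 0"
      proof (cases "x \<in> U")
        case True
        have "(\<lambda>n. x + v n) \<longlonglongrightarrow> x + 0" by (intro tendsto_intros v)
        from topological_tendstoD[OF this U(1)] True
        have "\<forall>\<^sub>F n in sequentially. x + v n \<in> U" by simp
        then show ?thesis
          by (intro Lim_transform_eventually[OF tendsto_const]) (use True in \<open>auto elim!: eventually_mono\<close>)
      qed auto
    qed
  qed (use i in \<open>auto simp: indicator_def\<close>)
  then have "(\<lambda>n. 2 * (\<integral>x. indicator U x * (1 - indicator U (x + v n) :: real) \<partial>lborel)) \<longlonglongrightarrow> 2 * 0"
    by (intro tendsto_mult tendsto_const) simp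
  moreover have "(\<integral>x. \<bar>indicator U (x + v n) - (indicator U x :: real)\<bar> \<partial>lborel) =
      2 * (\<integral>x. indicator U x * (1 - indicator U (x + v n) :: real) \<partial>lborel)" for n
  proof -
    have s: "integrable lborel (\<lambda>x. indicator U (x + v n) :: real)"
      by (rule lborel_integrable_shift[OF i])
    have j: "integrable lborel (\<lambda>x. indicator U x * (1 - indicator U (x + v n) :: real))"
      by (rule Bochner_Integration.integrable_bound[OF i]) (auto simp: indicator_def)
    have "(\<integral>x. \<bar>indicator U (x + v n) - (indicator U x :: real)\<bar> \<partial>lborel) =
      (\<integral>x. 2 * (indicator U x * (1 - indicator U (x + v n) :: real)) + (indicator U (x + v n) - indicator U x) \<partial>lborel)"
      by (intro Bochner_Integration.integral_cong) (auto simp: indicator_def)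
    also have "\<dots> = 2 * (\<integral>x. indicator U x * (1 - indicator U (x + v n) :: real) \<partial>lborel)
       + ((\<integral>x. indicator U (x + v n) \<partial>lborel) - (\<integral>x. indicator U x \<partial>lborel))"
      using i s j by simp
    also have "(\<integral>x. indicator U (x + v n) \<partial>lborel) = (\<integral>x. indicator U x \<partial>lborel :: real)"
      by (rule lborel_integral_shift) simp
    finally show ?thesis by simp
  qed
  ultimately show ?thesis by simp
qed

text \<open>Indicators of measurable sets are approximated from outside by open sets; the rest is the induction along simple functions.\<close>

lemma translation_L1:
  fixes f :: "'a::euclidean_space \<Rightarrow> real"
  assumes "integrable lborel f" and v: "v \<longlonglongrightarrow> 0"
  shows "(\<lambda>n. \<integral>x. \<bar>f (x + v n) - f x\<bar> \<partial>lborel) \<longlonglongrightarrow> 0"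
  using assms(1)
proof (induction rule: integrable_induct)
  case (base A c)
  have A: "(\<lambda>n. \<integral>x. \<bar>indicator A (x + v n) - (indicator A x :: real)\<bar> \<partial>lborel) \<longlonglongrightarrow> 0"
  proof (rule translation_L1_closed)
    show "integrable lborel (indicator A :: 'a \<Rightarrow> real)" using base by simp
    fix \<epsilon> :: real assume e: "\<epsilon> > 0"
    have "A \<in> sets lebesgue" using base by simp
    then obtain U where U: "open U" "A \<subseteq> U" "U - A \<in> lmeasurable" "emeasure lebesgue (U - A) < ennreal \<epsilon>"
      using sets_lebesgue_outer_open[OF _ e] by blast
    have [measurable]: "A \<in> sets borel" "U \<in> sets borel" using base U by auto
    have UA: "emeasure lborel (U - A) < ennreal \<epsilon>" using U by simp
    have "emeasure lborel U = emeasure lborel A + emeasure lborel (U - A)"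
      using U(2) by (subst plus_emeasure) (auto intro!: arg_cong[where f="emeasure lborel"])
    moreover have "emeasure lborel (U - A) < \<infinity>" using UA by (simp add: order.strict_trans[OF _ ennreal_less_top])
    ultimately have U': "emeasure lborel U < \<infinity>" using base by (simp add: less_top)
    have "(\<integral>x. \<bar>indicator A x - (indicator U x :: real)\<bar> \<partial>lborel) = (\<integral>x. indicator (U - A) x \<partial>lborel)"
      using U(2) by (intro Bochner_Integration.integral_cong) (auto simp: indicator_def)
    also have "\<dots> \<le> \<epsilon>" using UA e by (simp add: measure_def enn2real_leI less_imp_le)
    finally have "(\<integral>x. \<bar>indicator A x - (indicator U x :: real)\<bar> \<partial>lborel) \<le> \<epsilon>" .
    then show "\<exists>g. integrable lborel g \<and> (\<integral>x. \<bar>indicator A x - g x\<bar> \<partial>lborel) \<le> \<epsilon> \<and>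
      (\<lambda>n. \<integral>x. \<bar>g (x + v n) - g x\<bar> \<partial>lborel) \<longlonglongrightarrow> 0"
      using translation_L1_open[OF U(1) U' v] U' U(1) by (intro exI[of _ "indicator U"]) auto
  qed
  have "(\<integral>x. \<bar>indicator A (x + v n) *\<^sub>R c - indicator A x *\<^sub>R c\<bar> \<partial>lborel) =
     (\<integral>x. \<bar>indicator A (x + v n) - (indicator A x :: real)\<bar> * \<bar>c\<bar> \<partial>lborel)" for n
    by (intro Bochner_Integration.integral_cong) (auto simp: indicator_def)
  then show ?case using tendsto_mult_left_zero[OF A, of "\<bar>c\<bar>"] by simp
next
  case (add f g)
  show ?case
  proof (rule tendsto_sandwich[OF _ _ tendsto_const])
    show "(\<lambda>n. (\<integral>x. \<bar>f (x + v n) - f x\<bar> \<partial>lborel) + (\<integral>x. \<bar>g (x + v n) - g x\<bar> \<partial>lborel)) \<longlonglongrightarrow> 0"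
      using tendsto_add[OF add.IH] by simp
    have "(\<integral>x. \<bar>f (x + v n) + g (x + v n) - (f x + g x)\<bar> \<partial>lborel) \<le>
      (\<integral>x. \<bar>f (x + v n) - f x\<bar> \<partial>lborel) + (\<integral>x. \<bar>g (x + v n) - g x\<bar> \<partial>lborel)" for n
    proof -
      note i = add.hyps lborel_integrable_shift[OF add.hyps(1), of "v n"] lborel_integrable_shift[OF add.hyps(2), of "v n"]
      have "(\<integral>x. \<bar>f (x + v n) + g (x + v n) - (f x + g x)\<bar> \<partial>lborel) \<le>
        (\<integral>x. \<bar>f (x + v n) - f x\<bar> + \<bar>g (x + v n) - g x\<bar> \<partial>lborel)"
        using i by (intro integral_mono Bochner_Integration.integrable_add integrable_abs
            Bochner_Integration.integrable_diff) auto
      then show ?thesis using i by simp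
    qed
    then show "\<forall>\<^sub>F n in sequentially. (\<integral>x. \<bar>f (x + v n) + g (x + v n) - (f x + g x)\<bar> \<partial>lborel) \<le>
      (\<integral>x. \<bar>f (x + v n) - f x\<bar> \<partial>lborel) + (\<integral>x. \<bar>g (x + v n) - g x\<bar> \<partial>lborel)" by simp
  qed simp
next
  case (lim f s)
  show ?case
  proof (rule translation_L1_closed[OF lim.hyps(4)])
    fix \<epsilon> :: real assume e: "\<epsilon> > 0"
    have "(\<lambda>i. \<integral>x. \<bar>f x - s i x\<bar> \<partial>lborel) \<longlonglongrightarrow> (\<integral>x. 0 \<partial>(lborel :: 'a measure))"
    proof (rule integral_dominated_convergence[where w = "\<lambda>x. 3 * \<bar>f x\<bar>"])
      have "\<bar>f x - s i x\<bar> \<le> 3 * \<bar>f x\<bar>" for i x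
        using lim.hyps(3)[of x i] by simp
      then show "AE x in lborel. norm \<bar>f x - s i x\<bar> \<le> 3 * \<bar>f x\<bar>" for i by simp
      have "(\<lambda>i. \<bar>f x - s i x\<bar>) \<longlonglongrightarrow> \<bar>f x - f x\<bar>" for x
        using lim.hyps(2)[of x] by (intro tendsto_intros) simp
      then show "AE x in lborel. (\<lambda>i. \<bar>f x - s i x\<bar>) \<longlonglongrightarrow> 0" by simp
    qed (use lim.hyps in auto)
    then obtain i where "(\<integral>x. \<bar>f x - s i x\<bar> \<partial>lborel) < \<epsilon>"
      using LIMSEQ_D[OF _ e, of "\<lambda>i. \<integral>x. \<bar>f x - s i x\<bar> \<partial>lborel" 0] by fastforce
    then show "\<exists>g. integrable lborel g \<and> (\<integral>x. \<bar>f x - g x\<bar> \<partial>lborel) \<le> \<epsilon> \<and>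
      (\<lambda>n. \<integral>x. \<bar>g (x + v n) - g x\<bar> \<partial>lborel) \<longlonglongrightarrow> 0"
      using lim by (intro exI[of _ "s i"]) auto
  qed
qed

text \<open>The sets over which \<open>h\<close> has integral 0 form a Dynkin system, and the open boxes are an intersection-stable generator of
the Borel sets.\<close>

lemma AE_zero_of_box_integrals:
  fixes h :: "real ^ 'n::finite \<Rightarrow> real"
  assumes h: "integrable lborel h"
    and box: "\<And>a b. (\<integral>x. indicator (box a b) x * h x \<partial>lborel) = 0"
  shows "AE x in lborel. h x = 0"
proof (rule density_unique_real[OF h])
  have [measurable]: "h \<in> borel_measurable borel" using h by auto
  have U: "(\<integral>x. h x \<partial>lborel) = 0"
  proof -
    let ?B = "\<lambda>n. box (- (\<chi> i. real n)) (\<chi> i. real n) :: (real ^ 'n) set"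
    have "(\<lambda>n. \<integral>x. indicator (?B n) x * h x \<partial>lborel) \<longlonglongrightarrow> (\<integral>x. h x \<partial>lborel)"
    proof (rule integral_dominated_convergence[where w = "\<lambda>x. \<bar>h x\<bar>"])
      show "AE x in lborel. (\<lambda>n. indicator (?B n) x * h x) \<longlonglongrightarrow> h x"
      proof (rule AE_I2)
        fix x :: "real ^ 'n"
        obtain N where N: "norm x < real N" using reals_Archimedean2 by blast
        have "x \<in> ?B n" if "n \<ge> N" for n
        proof -
          have "\<bar>x $ i\<bar> < real n" for i
            using component_le_norm_cart[of x i] N that by (meson less_le_trans of_nat_le_iff le_less_trans)
          then show ?thesis by (auto simp: mem_box_cart abs_less_iff minus_less_iff)
        qed
        then show "(\<lambda>n. indicator (?B n) x * h x) \<longlonglongrightarrow> h x"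
          by (intro Lim_transform_eventually[OF tendsto_const] eventually_sequentiallyI[of N]) auto
      qed
    qed (use h in \<open>auto simp: indicator_def\<close>)
    then show ?thesis by (simp add: box LIMSEQ_const_iff)
  qed
  fix A assume "A \<in> sets (lborel :: (real ^ 'n) measure)"
  then have A: "A \<in> sigma_sets UNIV (range (\<lambda>(a, b). box a b))"
    by (simp add: borel_eq_box)
  have I: "Int_stable (range (\<lambda>(a, b). box a b :: (real ^ 'n) set))"
    unfolding Int_stable_def by (auto simp: box_Int_box image_iff)
  have P: "range (\<lambda>(a, b). box a b :: (real ^ 'n) set) \<subseteq> Pow UNIV" by simp
  from I P A have "(\<integral>x. indicator A x * h x \<partial>lborel) = 0"
  proof (induction rule: sigma_sets_induct_disjoint)
    case (compl A)
    then have [measurable]: "A \<in> sets borel" by (simp add: borel_eq_box)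
    have "(\<integral>x. indicator (UNIV - A) x * h x \<partial>lborel) = (\<integral>x. h x - indicator A x * h x \<partial>lborel)"
      by (intro Bochner_Integration.integral_cong) (auto simp: indicator_def)
    also have "\<dots> = 0"
      using compl.IH U integrable_mult_indicator[of A lborel h] h by simp
    finally show ?case .
  next
    case (union A)
    from union(2) have [measurable]: "A i \<in> sets borel" for i
      by (simp add: borel_eq_box range_subsetD)
    have [measurable]: "(\<Union>i. A i) \<in> sets borel" by measurable
    have "integrable lborel (\<lambda>x. indicator (\<Union>i. A i) x *\<^sub>R h x)"
      by (rule integrable_mult_indicator[OF _ h]) simp
    then have "(LINT x:(\<Union>i. A i)|lborel. h x) = (\<Sum>i. LINT x:A i|lborel. h x)"
      using union.hyps h
      by (intro lebesgue_integral_countable_add) (auto simp: disjoint_family_on_def set_integrable_def)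
    then show ?case using union.IH by (simp add: set_lebesgue_integral_def)
  qed (auto simp: box)
  then show "(LINT x:A|lborel. h x) = (LINT x:A|lborel. 0)"
    by (simp add: set_lebesgue_integral_def)
qed simp

section \<open>The fundamental lemma of the calculus of variations\<close>

text \<open>Fubini's theorem needs functions that are jointly measurable in the point and the step length. Borel functions remain
measurable under composition with \<open>(x, s) \<mapsto> x + s v\<close>, Lebesgue measurable ones need not; so every argument that uses Fubini is carried
out for Borel representatives.\<close>

lemma integrable_lebesgue_borel_rep:
  fixes f :: "'a::euclidean_space \<Rightarrow> real"
  assumes f: "integrable lebesgue f"
  obtains f' where "integrable lborel f'" "AE x in lborel. f x = f' x"
    "\<And>\<phi>. \<phi> \<in> borel_measurable borel \<Longrightarrow> (\<integral>x. f x * \<phi> x \<partial>lebesgue) = (\<integral>x. f' x * \<phi> x \<partial>lborel)"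
proof -
  have fm: "f \<in> borel_measurable lebesgue" using f by auto
  then obtain f' where m[measurable]: "f' \<in> borel_measurable borel" and ae: "AE x in lborel. f x = f' x"
    using completion_ex_borel_measurable_real[of f lborel] by auto
  have m': "f' \<in> borel_measurable lebesgue" by (rule measurable_completion) simp
  have ae': "AE x in lebesgue. f x = f' x" using ae by (simp add: AE_completion_iff)
  have "integrable lebesgue f'" using integrable_cong_AE[OF fm m' ae'] f by simp
  then have "integrable lborel f'" by (simp add: integrable_completion)
  moreover have "(\<integral>x. f x * \<phi> x \<partial>lebesgue) = (\<integral>x. f' x * \<phi> x \<partial>lborel)"
    if p[measurable]: "\<phi> \<in> borel_measurable borel" for \<phi>
  proof -
    have p': "\<phi> \<in> borel_measurable lebesgue" by (rule measurable_completion) simp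
    have "(\<integral>x. f x * \<phi> x \<partial>lebesgue) = (\<integral>x. f' x * \<phi> x \<partial>lebesgue)"
      using ae' by (intro integral_cong_AE borel_measurable_times fm m' p') (auto elim: eventually_mono)
    also have "\<dots> = (\<integral>x. f' x * \<phi> x \<partial>lborel)" by (rule integral_completion) simp
    finally show ?thesis .
  qed
  ultimately show ?thesis using ae that by blast
qed

lemma test_function_zero_outside: "\<phi> \<in> test_functions \<Omega> \<Longrightarrow> x \<notin> \<Omega> \<Longrightarrow> \<phi> x = 0"
  unfolding test_functions_def using closure_subset[of "{x. \<phi> x \<noteq> 0}"] by blast

lemma test_function_partials:
  "\<phi> \<in> test_functions \<Omega> \<Longrightarrow> partials \<alpha> \<phi> \<in> test_functions \<Omega>"
  by (induction \<alpha>) (auto intro: test_function_partial)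

lemma set_integral_times_test_function:
  assumes "\<phi> \<in> test_functions \<Omega>"
  shows "(LINT x:\<Omega>|M. h x * \<phi> x) = (\<integral>x. h x * \<phi> x \<partial>M)"
  unfolding set_lebesgue_integral_def using test_function_zero_outside[OF assms]
  by (intro Bochner_Integration.integral_cong) (auto simp: indicator_def)

lemma locally_integrable_times_test_function:
  assumes h: "locally_integrable \<Omega> h" and p: "\<phi> \<in> test_functions \<Omega>"
  shows "integrable lebesgue (\<lambda>x. h x * \<phi> x)"
proof -
  let ?K = "closure {x. \<phi> x \<noteq> 0}"
  have K: "integrable lebesgue (\<lambda>x. indicator ?K x *\<^sub>R h x)"
    using h p unfolding locally_integrable_def test_functions_def set_integrable_def by auto
  obtain B where B: "\<And>x. \<bar>\<phi> x\<bar> \<le> B" using test_function_bounded[OF p] by blast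
  have pm: "\<phi> \<in> borel_measurable lebesgue"
    using test_function_measurable[OF p] by (intro measurable_completion) simp
  have "integrable lebesgue (\<lambda>x. (indicator ?K x *\<^sub>R h x) * \<phi> x)"
  proof (rule Bochner_Integration.integrable_bound)
    show "integrable lebesgue (\<lambda>x. B * (indicator ?K x *\<^sub>R h x))" using K by simp
    show "(\<lambda>x. indicator ?K x *\<^sub>R h x * \<phi> x) \<in> borel_measurable lebesgue"
      using K pm by (intro borel_measurable_times) auto
    show "AE x in lebesgue. norm (indicator ?K x *\<^sub>R h x * \<phi> x) \<le> norm (B * (indicator ?K x *\<^sub>R h x))"
      using B by (intro AE_I2) (auto simp: abs_mult indicator_def mult.commute intro!: mult_right_mono order_trans[OF B abs_ge_self])
  qed
  moreover have "(\<lambda>x. (indicator ?K x *\<^sub>R h x) * \<phi> x) = (\<lambda>x. h x * \<phi> x)"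
    using closure_subset[of "{x. \<phi> x \<noteq> 0}"] by (auto simp: fun_eq_iff indicator_def)
  ultimately show ?thesis by simp
qed

lemma locally_integrable_linear:
  "locally_integrable \<Omega> f \<Longrightarrow> locally_integrable \<Omega> g \<Longrightarrow> locally_integrable \<Omega> (\<lambda>x. c * f x + d * g x)"
  unfolding locally_integrable_def by (auto intro!: set_integral_add)

lemma locally_integrable_imp_integrable:
  "set_integrable lebesgue \<Omega> f \<Longrightarrow> locally_integrable \<Omega> f"
  unfolding locally_integrable_def
  by (auto intro!: set_integrable_subset[of lebesgue \<Omega>] fmeasurableD lmeasurable_compact)

text \<open>Locally \<open>h\<close> is tested against bump functions that tend to the indicator of a box; so all integrals of \<open>h\<close> over small boxes vanish.\<close>

lemma fundamental_lemma_calculus_of_variations: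
  fixes \<Omega> :: "(real ^ 'n::finite) set"
  assumes "open \<Omega>" and h: "locally_integrable \<Omega> h"
    and z: "\<And>\<phi>. \<phi> \<in> test_functions \<Omega> \<Longrightarrow> (\<integral>x. h x * \<phi> x \<partial>lebesgue) = 0"
  shows "AE x in lebesgue. x \<in> \<Omega> \<longrightarrow> h x = 0"
proof (rule AE_locally)
  fix x assume "x \<in> \<Omega>"
  then obtain a b where ab: "cbox a b \<subseteq> \<Omega>" "x \<in> box a b"
    using open_contains_cbox[OF \<open>open \<Omega>\<close>] by metis
  have "set_integrable lebesgue (cbox a b) h" using h ab unfolding locally_integrable_def by auto
  then have "integrable lebesgue (\<lambda>x. indicator (box a b) x *\<^sub>R h x)"
    unfolding set_integrable_def[symmetric] by (rule set_integrable_subset) (auto simp: box_subset_cbox)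
  then obtain h' where h': "integrable lborel h'" and ae: "AE x in lborel. indicator (box a b) x *\<^sub>R h x = h' x"
    and i: "\<And>\<phi>. \<phi> \<in> borel_measurable borel \<Longrightarrow>
      (\<integral>x. (indicator (box a b) x *\<^sub>R h x) * \<phi> x \<partial>lebesgue) = (\<integral>x. h' x * \<phi> x \<partial>lborel)"
    by (rule integrable_lebesgue_borel_rep) (rule that)
  have [measurable]: "h' \<in> borel_measurable borel" using h' by auto
  have "AE x in lborel. h' x = 0"
  proof (rule AE_zero_of_box_integrals[OF h'])
    fix c d :: "real ^ 'n"
    define c' d' :: "real ^ 'n" where "c' = (\<chi> i. max (a $ i) (c $ i))" and "d' = (\<chi> i. min (b $ i) (d $ i))"
    have box: "box a b \<inter> box c d = box c' d'" by (auto simp: mem_box_cart c'_def d'_def)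
    have "cbox c' d' \<subseteq> cbox a b" by (auto simp: mem_box_cart c'_def d'_def)
    then have t: "bump c' d' n \<in> test_functions \<Omega>" for n using ab by (intro bump_test_function) auto
    have "(\<integral>x. h' x * bump c' d' n x \<partial>lborel) = 0" for n
    proof -
      have "(\<integral>x. h' x * bump c' d' n x \<partial>lborel) = (\<integral>x. (indicator (box a b) x *\<^sub>R h x) * bump c' d' n x \<partial>lebesgue)"
        by (rule i[symmetric]) (rule test_function_measurable[OF t])
      also have "\<dots> = (\<integral>x. h x * bump c' d' n x \<partial>lebesgue)"
        using bump_support[of _ c' d' n] box by (intro Bochner_Integration.integral_cong) (auto simp: indicator_def)
      finally show ?thesis using z[OF t] by simp
    qed
    moreover have "(\<lambda>n. \<integral>x. h' x * bump c' d' n x \<partial>lborel) \<longlonglongrightarrow> (\<integral>x. h' x * indicator (box c' d') x \<partial>lborel)"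
    proof (rule integral_dominated_convergence[where w = "\<lambda>x. \<bar>h' x\<bar>"])
      show "(\<lambda>x. h' x * bump c' d' n x) \<in> borel_measurable lborel" for n
        using test_function_measurable[OF t[of n]] by simp
      show "AE x in lborel. norm (h' x * bump c' d' n x) \<le> \<bar>h' x\<bar>" for n
        using bump_abs_le_1 by (intro AE_I2) (auto simp: abs_mult intro!: mult_left_le)
      show "AE x in lborel. (\<lambda>n. h' x * bump c' d' n x) \<longlonglongrightarrow> h' x * indicator (box c' d') x"
        by (intro AE_I2 tendsto_intros bump_tendsto)
    qed (use h' in auto)
    ultimately have "(\<integral>x. h' x * indicator (box c' d') x \<partial>lborel) = 0" by (simp add: LIMSEQ_const_iff)
    moreover have "(\<integral>x. indicator (box c d) x * h' x \<partial>lborel) = (\<integral>x. h' x * indicator (box c' d') x \<partial>lborel)"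
      using ae unfolding box[symmetric]
      by (intro integral_cong_AE) (auto elim!: eventually_mono simp: indicator_def split: if_splits)
    ultimately show "(\<integral>x. indicator (box c d) x * h' x \<partial>lborel) = 0" by simp
  qed
  with ae have "AE y in lborel. y \<in> box a b \<longrightarrow> h y = 0"
    by eventually_elim (auto simp: indicator_def split: if_splits)
  then show "\<exists>U. open U \<and> x \<in> U \<and> (AE y in lebesgue. y \<in> U \<longrightarrow> h y = 0)"
    using ab by (intro exI[of _ "box a b"]) (auto simp: AE_completion_iff)
qed

section \<open>Weak derivatives\<close>

lemma has_weak_deriv_iff:
  "has_weak_deriv \<Omega> \<alpha> f g \<longleftrightarrow> locally_integrable \<Omega> f \<and> locally_integrable \<Omega> g \<and>
    (\<forall>\<phi> \<in> test_functions \<Omega>. (\<integral>x. f x * partials \<alpha> \<phi> x \<partial>lebesgue) =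
      (- 1) ^ length \<alpha> * (\<integral>x. g x * \<phi> x \<partial>lebesgue))"
  unfolding has_weak_deriv_def by (simp add: set_integral_times_test_function test_function_partials)

lemma has_weak_deriv_linear:
  assumes "has_weak_deriv \<Omega> \<alpha> f g" "has_weak_deriv \<Omega> \<alpha> f' g'"
  shows "has_weak_deriv \<Omega> \<alpha> (\<lambda>x. c * f x + d * f' x) (\<lambda>x. c * g x + d * g' x)"
proof -
  have *: "(\<integral>x. (c * p x + d * q x) * \<phi> x \<partial>lebesgue) =
      c * (\<integral>x. p x * \<phi> x \<partial>lebesgue) + d * (\<integral>x. q x * \<phi> x \<partial>lebesgue)"
    if "locally_integrable \<Omega> p" "locally_integrable \<Omega> q" "\<phi> \<in> test_functions \<Omega>" for p q \<phi>
  proof -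
    have "(\<integral>x. (c * p x + d * q x) * \<phi> x \<partial>lebesgue) =
      (\<integral>x. c * (p x * \<phi> x) + d * (q x * \<phi> x) \<partial>lebesgue)"
      by (simp add: algebra_simps)
    then show ?thesis using that by (simp add: locally_integrable_times_test_function)
  qed
  show ?thesis
    using assms unfolding has_weak_deriv_iff
    by (auto intro!: locally_integrable_linear simp: * test_function_partials distrib_left mult.left_commute[of _ "(- 1) ^ length \<alpha>"])
qed

lemma has_weak_deriv_unique:
  fixes \<Omega> :: "(real ^ 'n::finite) set"
  assumes "open \<Omega>" and g: "has_weak_deriv \<Omega> \<alpha> f g" and g': "has_weak_deriv \<Omega> \<alpha> f g'"
  shows "AE x in lebesgue. x \<in> \<Omega> \<longrightarrow> g x = g' x"
proof -
  have d: "has_weak_deriv \<Omega> \<alpha> (\<lambda>x. 1 * f x + (- 1) * f x) (\<lambda>x. 1 * g x + (- 1) * g' x)"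
    by (rule has_weak_deriv_linear[OF g g'])
  have "AE x in lebesgue. x \<in> \<Omega> \<longrightarrow> 1 * g x + (- 1) * g' x = 0"
    using d unfolding has_weak_deriv_iff by (intro fundamental_lemma_calculus_of_variations[OF \<open>open \<Omega>\<close>]) auto
  then show ?thesis by eventually_elim auto
qed

lemma has_weak_deriv_weak_deriv:
  "has_weak_deriv \<Omega> \<alpha> f g \<Longrightarrow> has_weak_deriv \<Omega> \<alpha> f (weak_deriv \<Omega> \<alpha> f)"
  unfolding weak_deriv_def by (rule someI[of "has_weak_deriv \<Omega> \<alpha> f"])

lemma weak_deriv_AE_eq:
  fixes \<Omega> :: "(real ^ 'n::finite) set"
  shows "open \<Omega> \<Longrightarrow> has_weak_deriv \<Omega> \<alpha> f g \<Longrightarrow> AE x in lebesgue. x \<in> \<Omega> \<longrightarrow> weak_deriv \<Omega> \<alpha> f x = g x"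
  using has_weak_deriv_unique has_weak_deriv_weak_deriv by blast

lemma has_weak_deriv_Nil: "locally_integrable \<Omega> f \<Longrightarrow> has_weak_deriv \<Omega> [] f f"
  unfolding has_weak_deriv_iff by simp

text \<open>In the list \<open>[i, k]\<close> the operator \<open>\<partial>\<^sub>k\<close> acts on the test function first, so \<open>\<partial>\<^sub>k \<phi>\<close> is the
test function to be inserted in the definition of \<open>g\<close>. This determines the order of the indices.\<close>

lemma weak_deriv_of_weak_deriv:
  assumes f: "has_weak_deriv \<Omega> [i] f g" and f2: "has_weak_deriv \<Omega> [i, k] f h"
  shows "has_weak_deriv \<Omega> [k] g h"
  unfolding has_weak_deriv_iff
proof (intro conjI ballI)
  fix \<phi> assume p: "\<phi> \<in> test_functions \<Omega>"
  have "(\<integral>x. f x * partials [i, k] \<phi> x \<partial>lebesgue) = (\<integral>x. h x * \<phi> x \<partial>lebesgue)"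
    using f2 p unfolding has_weak_deriv_iff by auto
  moreover have "(\<integral>x. f x * partials [i] (partial k \<phi>) x \<partial>lebesgue) = - (\<integral>x. g x * partial k \<phi> x \<partial>lebesgue)"
    using f test_function_partial[OF p, of k] unfolding has_weak_deriv_iff by auto
  ultimately show "(\<integral>x. g x * partials [k] \<phi> x \<partial>lebesgue) = (- 1) ^ length [k] * (\<integral>x. h x * \<phi> x \<partial>lebesgue)"
    by simp
qed (use assms in \<open>auto simp: has_weak_deriv_iff\<close>)

lemma has_weak_deriv_swap:
  assumes "has_weak_deriv \<Omega> [i, j] f g" shows "has_weak_deriv \<Omega> [j, i] f g"
proof -
  have "partials [j, i] \<phi> = partials [i, j] \<phi>" if "\<phi> \<in> test_functions \<Omega>" for \<phi>
    using that smooth_partial_commute[of \<phi>] by (auto simp: test_functions_def)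
  then show ?thesis using assms unfolding has_weak_deriv_iff by auto
qed

section \<open>Increments and difference quotients of weakly differentiable functions\<close>

lemma integrable_segments:
  fixes g :: "'a::euclidean_space \<Rightarrow> real"
  assumes g: "integrable lborel g"
  shows "integrable (lborel \<Otimes>\<^sub>M lborel) (\<lambda>(x, s). indicator {0..1} s * g (x + s *\<^sub>R v))"
proof (rule integrableI_bounded)
  have [measurable]: "g \<in> borel_measurable borel" using g by auto
  show "(\<lambda>(x, s). indicator {0..1::real} s * g (x + s *\<^sub>R v)) \<in> borel_measurable (lborel \<Otimes>\<^sub>M lborel)"
    by measurable
  have m: "(\<lambda>(x, s). ennreal (norm (indicator {0..1::real} s * g (x + s *\<^sub>R v)))) \<in> borel_measurable (lborel \<Otimes>\<^sub>M lborel)"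
    by measurable
  have "(\<integral>\<^sup>+ z. ennreal (norm (case z of (x, s) \<Rightarrow> indicator {0..1::real} s * g (x + s *\<^sub>R v))) \<partial>(lborel \<Otimes>\<^sub>M lborel)) =
    (\<integral>\<^sup>+ s. \<integral>\<^sup>+ x. ennreal (norm (indicator {0..1::real} s * g (x + s *\<^sub>R v))) \<partial>lborel \<partial>lborel)"
    using lborel_pair.nn_integral_snd[OF m] by (simp add: case_prod_beta')
  also have "\<dots> = (\<integral>\<^sup>+ s. indicator {0..1::real} s * (\<integral>\<^sup>+ x. ennreal \<bar>g x\<bar> \<partial>lborel) \<partial>lborel)"
  proof (rule nn_integral_cong)
    fix s :: real
    have "(\<integral>\<^sup>+ x. ennreal (norm (indicator {0..1::real} s * g (x + s *\<^sub>R v))) \<partial>lborel) =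
      (\<integral>\<^sup>+ x. indicator {0..1::real} s * ennreal \<bar>g (x + s *\<^sub>R v)\<bar> \<partial>lborel)"
      by (intro nn_integral_cong) (auto simp: indicator_def)
    also have "\<dots> = indicator {0..1::real} s * (\<integral>\<^sup>+ x. ennreal \<bar>g (x + s *\<^sub>R v)\<bar> \<partial>lborel)"
      by (rule nn_integral_cmult) simp
    also have "(\<integral>\<^sup>+ x. ennreal \<bar>g (x + s *\<^sub>R v)\<bar> \<partial>lborel) = (\<integral>\<^sup>+ x. ennreal \<bar>g x\<bar> \<partial>lborel)"
      by (rule lborel_nn_integral_shift[of "\<lambda>x. ennreal \<bar>g x\<bar>"]) simp
    finally show "(\<integral>\<^sup>+ x. ennreal (norm (indicator {0..1::real} s * g (x + s *\<^sub>R v))) \<partial>lborel) =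
      indicator {0..1::real} s * (\<integral>\<^sup>+ x. ennreal \<bar>g x\<bar> \<partial>lborel)" .
  qed
  also have "\<dots> = (\<integral>\<^sup>+ x. ennreal \<bar>g x\<bar> \<partial>lborel)"
    by (subst nn_integral_multc) auto
  also have "\<dots> < \<infinity>" using g unfolding integrable_iff_bounded by simp
  finally show "(\<integral>\<^sup>+ z. ennreal (norm (case z of (x, s) \<Rightarrow> indicator {0..1::real} s * g (x + s *\<^sub>R v))) \<partial>(lborel \<Otimes>\<^sub>M lborel)) < \<infinity>" .
qed

lemma integrable_segments_mult:
  fixes g :: "'a::euclidean_space \<Rightarrow> real"
  assumes g: "integrable lborel g" and [measurable]: "\<phi> \<in> borel_measurable borel" and B: "\<And>x. \<bar>\<phi> x\<bar> \<le> B"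
  shows "integrable (lborel \<Otimes>\<^sub>M lborel) (\<lambda>(x, s). indicator {0..1} s * (g (x + s *\<^sub>R v) * \<phi> (x + s *\<^sub>R w)))"
proof (rule Bochner_Integration.integrable_bound)
  have [measurable]: "g \<in> borel_measurable borel" using g by auto
  show "(\<lambda>(x, s). indicator {0..1::real} s * (g (x + s *\<^sub>R v) * \<phi> (x + s *\<^sub>R w))) \<in> borel_measurable (lborel \<Otimes>\<^sub>M lborel)"
    by measurable
  show "integrable (lborel \<Otimes>\<^sub>M lborel) (\<lambda>z. B * (case z of (x, s) \<Rightarrow> indicator {0..1} s * g (x + s *\<^sub>R v)))"
    using integrable_segments[OF g, of v] by simp
  have "\<bar>g y\<bar> * \<bar>\<phi> z\<bar> \<le> \<bar>B\<bar> * \<bar>g y\<bar>" for y z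
    using mult_left_mono[OF order_trans[OF B abs_ge_self], of "\<bar>g y\<bar>" z] by (simp add: mult.commute)
  then show "AE z in lborel \<Otimes>\<^sub>M lborel. norm (case z of (x, s) \<Rightarrow> indicator {0..1} s * (g (x + s *\<^sub>R v) * \<phi> (x + s *\<^sub>R w)))
      \<le> norm (B * (case z of (x, s) \<Rightarrow> indicator {0..1::real} s * g (x + s *\<^sub>R v)))"
    by (intro AE_I2) (auto simp: abs_mult indicator_def)
qed

text \<open>The increment \<open>f (x + e\<^sub>i) - f x\<close> has integral 0 by translation invariance; by Fubini its integral equals
that of \<open>\<partial>\<^sub>i f\<close>.\<close>

lemma integral_partial_eq_0:
  fixes f :: "real ^ 'n::finite \<Rightarrow> real"
  assumes d: "\<And>x. f differentiable (at x)" and c: "continuous_on UNIV (partial i f)"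
    and f: "integrable lborel f" and pf: "integrable lborel (partial i f)"
  shows "(\<integral>x. partial i f x \<partial>lborel) = 0"
proof -
  let ?e = "axis i 1 :: real ^ 'n"
  have [measurable]: "f \<in> borel_measurable borel" "partial i f \<in> borel_measurable borel" using f pf by auto
  have "0 = (\<integral>x. f (x + ?e) - f x \<partial>lborel)"
    using lborel_integral_shift[of f ?e] lborel_integrable_shift[OF f, of ?e] f by simp
  also have "\<dots> = (\<integral>x. (\<integral>s. indicator {0..1} s * partial i f (x + s *\<^sub>R ?e) \<partial>lborel) \<partial>lborel)"
    using increment_formula[OF d c, of _ 1] by simp
  also have "\<dots> = (\<integral>s. (\<integral>x. indicator {0..1} s * partial i f (x + s *\<^sub>R ?e) \<partial>lborel) \<partial>lborel)"
    by (rule lborel_pair.Fubini_integral[OF integrable_segments[OF pf], symmetric])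
  also have "\<dots> = (\<integral>s. indicator {0..1::real} s * (\<integral>x. partial i f x \<partial>lborel) \<partial>lborel)"
    using lborel_integral_shift[of "partial i f"] by simp
  also have "\<dots> = (\<integral>x. partial i f x \<partial>lborel)" by simp
  finally show ?thesis by simp
qed

lemma test_function_has_weak_deriv:
  assumes p: "\<phi> \<in> test_functions (\<Omega> :: (real ^ 'n::finite) set)"
  shows "has_weak_deriv \<Omega> [i] \<phi> (partial i \<phi>)"
proof -
  have li: "locally_integrable \<Omega> \<psi>" if "\<psi> \<in> test_functions \<Omega>" for \<psi>
    using that unfolding locally_integrable_def
    by (auto intro!: test_function_set_integrable fmeasurableD lmeasurable_compact)
  have "(\<integral>x. \<phi> x * partial i \<eta> x \<partial>lebesgue) = - (\<integral>x. partial i \<phi> x * \<eta> x \<partial>lebesgue)"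
    if e: "\<eta> \<in> test_functions \<Omega>" for \<eta>
  proof -
    note t = p e test_function_partial[OF p, of i] test_function_partial[OF e, of i]
    note [measurable] = t[THEN test_function_measurable]
    have sm: "smooth \<phi>" "smooth \<eta>" using p e by (auto simp: test_functions_def)
    have prod: "integrable lborel (\<lambda>x. \<alpha> x * \<beta> x)"
      if "\<alpha> \<in> test_functions \<Omega>" "\<beta> \<in> test_functions \<Omega>" for \<alpha> \<beta>
      by (rule integrable_times_test_function[OF test_function_integrable[OF that(1)] that(2)])
    have eq: "partial i (\<lambda>x. \<phi> x * \<eta> x) = (\<lambda>x. \<phi> x * partial i \<eta> x + partial i \<phi> x * \<eta> x)"
      using smooth_has_partial[OF sm(1), of _ i 0] smooth_has_partial[OF sm(2), of _ i 0]
      by (intro partial_eqI) (auto intro!: derivative_eq_intros)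
    have "(\<integral>x. partial i (\<lambda>x. \<phi> x * \<eta> x) x \<partial>lborel) = 0"
    proof (rule integral_partial_eq_0)
      show "(\<lambda>x. \<phi> x * \<eta> x) differentiable (at x)" for x
        by (intro derivative_intros smooth_differentiable sm)
      show "continuous_on UNIV (partial i (\<lambda>x. \<phi> x * \<eta> x))"
        unfolding eq by (intro continuous_intros test_function_continuous[OF t(1)] test_function_continuous[OF t(2)]
            test_function_continuous[OF t(3)] test_function_continuous[OF t(4)])
      show "integrable lborel (\<lambda>x. \<phi> x * \<eta> x)" by (intro prod t)
      show "integrable lborel (partial i (\<lambda>x. \<phi> x * \<eta> x))"
        unfolding eq by (intro Bochner_Integration.integrable_add prod t)
    qed
    then have "(\<integral>x. \<phi> x * partial i \<eta> x \<partial>lborel) = - (\<integral>x. partial i \<phi> x * \<eta> x \<partial>lborel)"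
      unfolding eq by (subst (asm) Bochner_Integration.integral_add) (auto intro!: prod t)
    then show ?thesis by (simp add: integral_completion)
  qed
  then show ?thesis
    unfolding has_weak_deriv_iff using li p test_function_partial[OF p] by auto
qed

text \<open>The two sides are compared after multiplication with a test function \<open>\<phi>\<close> supported in the ball. A translation
moves the increment from \<open>f'\<close> to \<open>\<phi>\<close>, where it is the integral of \<open>\<partial>\<^sub>k \<phi>\<close> over a segment; Fubini and the
definition of the weak derivative, applied to the translates of \<open>\<phi>\<close>, bring it back to \<open>g'\<close>. The ball of twice the radius
contains the supports of all these translates. The functions \<open>f'\<close> and \<open>g'\<close> stand for integrable Borel representatives of \<open>f\<close>
and \<open>g\<close> on that larger ball.\<close>

lemma weak_deriv_increment:
  fixes \<Omega> :: "(real ^ 'n::finite) set"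
  assumes w: "has_weak_deriv \<Omega> [k] f g" and r: "cball x0 (2 * r) \<subseteq> \<Omega>" and t: "\<bar>t\<bar> \<le> r"
    and f': "integrable lborel f'" and g': "integrable lborel g'"
    and ff: "\<And>\<phi>. \<phi> \<in> borel_measurable borel \<Longrightarrow>
      (\<integral>x. (indicator (cball x0 (2 * r)) x * f x) * \<phi> x \<partial>lebesgue) = (\<integral>x. f' x * \<phi> x \<partial>lborel)"
    and gg: "\<And>\<phi>. \<phi> \<in> borel_measurable borel \<Longrightarrow>
      (\<integral>x. (indicator (cball x0 (2 * r)) x * g x) * \<phi> x \<partial>lebesgue) = (\<integral>x. g' x * \<phi> x \<partial>lborel)"
  shows "AE x in lborel. x \<in> ball x0 r \<longrightarrow>
    f' (x + t *\<^sub>R axis k 1) - f' x = t * (\<integral>s. indicator {0..1} s * g' (x + s *\<^sub>R (t *\<^sub>R axis k 1)) \<partial>lborel)"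
proof -
  define v :: "real ^ 'n" where "v = t *\<^sub>R axis k 1"
  have nv: "norm v = \<bar>t\<bar>" by (simp add: v_def)
  have [measurable]: "f' \<in> borel_measurable borel" "g' \<in> borel_measurable borel" using f' g' by auto
  define G where "G x = (\<integral>s. indicator {0..1} s * g' (x + s *\<^sub>R v) \<partial>lborel)" for x
  have Gi: "integrable lborel G"
    unfolding G_def by (rule lborel_pair.integrable_fst[OF integrable_segments[OF g']])
  define h where "h x = f' (x + v) - f' x - t * G x" for x
  have hi: "integrable lborel h"
    unfolding h_def using lborel_integrable_shift[OF f', of v] f' Gi by auto
  have [measurable]: "G \<in> borel_measurable borel" "h \<in> borel_measurable borel" using Gi hi by auto
  have "(\<integral>x. h x * \<phi> x \<partial>lebesgue) = 0" if p: "\<phi> \<in> test_functions (ball x0 r)" for \<phi>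
  proof -
    have pm[measurable]: "\<phi> \<in> borel_measurable borel" by (rule test_function_measurable[OF p])
    have pm'[measurable]: "partial k \<phi> \<in> borel_measurable borel" by (rule test_function_measurable[OF test_function_partial[OF p]])
    obtain B where B: "\<And>x. \<bar>\<phi> x\<bar> \<le> B" using test_function_bounded[OF p] by blast
    obtain B' where B': "\<And>x. \<bar>partial k \<phi> x\<bar> \<le> B'" using test_function_bounded[OF test_function_partial[OF p]] by blast
    note pi = integrable_times_test_function[OF _ p]
    have shift: "(\<integral>x. f' x * partial k \<phi> (x + s *\<^sub>R (- v)) \<partial>lborel) = - (\<integral>x. g' x * \<phi> (x + s *\<^sub>R (- v)) \<partial>lborel)"
      if s: "s \<in> {0..1}" for s
    proof -
      define \<psi> where "\<psi> x = \<phi> (x + s *\<^sub>R (- v))" for x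
      have sub: "(\<lambda>x. x - s *\<^sub>R (- v)) ` ball x0 r \<subseteq> cball x0 (2 * r)"
      proof
        fix y assume "y \<in> (\<lambda>x. x - s *\<^sub>R (- v)) ` ball x0 r"
        then obtain x where x: "x \<in> ball x0 r" "y = x + s *\<^sub>R v" by auto
        have "norm (s *\<^sub>R v) \<le> r"
        proof -
          have "\<bar>s\<bar> * \<bar>t\<bar> \<le> 1 * r" using s t by (intro mult_mono) auto
          then show ?thesis by (simp add: nv)
        qed
        moreover have "norm (x0 - y) \<le> norm (x0 - x) + norm (s *\<^sub>R v)"
          unfolding x using norm_triangle_ineq4[of "x0 - x" "s *\<^sub>R v"] by (simp add: algebra_simps)
        ultimately show "y \<in> cball x0 (2 * r)" using x by (simp add: dist_norm)
      qed
      have ps: "\<psi> \<in> test_functions (cball x0 (2 * r))"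
        unfolding \<psi>_def by (rule test_function_mono[OF test_function_shift[OF p] sub])
      have ps': "\<psi> \<in> test_functions \<Omega>" by (rule test_function_mono[OF ps r])
      have pp: "partial k \<psi> \<in> test_functions (cball x0 (2 * r))" by (rule test_function_partial[OF ps])
      have pk: "partial k \<psi> = (\<lambda>x. partial k \<phi> (x + s *\<^sub>R (- v)))"
        unfolding \<psi>_def by (rule partial_shift)
      have "(\<integral>x. f x * partial k \<psi> x \<partial>lebesgue) = - (\<integral>x. g x * \<psi> x \<partial>lebesgue)"
        using w ps' unfolding has_weak_deriv_iff by auto
      also have "(\<integral>x. f x * partial k \<psi> x \<partial>lebesgue) = (\<integral>x. (indicator (cball x0 (2 * r)) x * f x) * partial k \<psi> x \<partial>lebesgue)"
        using test_function_zero_outside[OF pp] by (intro Bochner_Integration.integral_cong) (auto simp: indicator_def)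
      also have "(\<integral>x. g x * \<psi> x \<partial>lebesgue) = (\<integral>x. (indicator (cball x0 (2 * r)) x * g x) * \<psi> x \<partial>lebesgue)"
        using test_function_zero_outside[OF ps] by (intro Bochner_Integration.integral_cong) (auto simp: indicator_def)
      finally show ?thesis
        unfolding ff[OF test_function_measurable[OF pp]] gg[OF test_function_measurable[OF ps]]
        by (simp add: pk \<psi>_def)
    qed
    have inc: "\<phi> (x + - v) - \<phi> x = (\<integral>s. indicator {0..1} s * (- t * partial k \<phi> (x + s *\<^sub>R (- v))) \<partial>lborel)" for x
      using test_function_increment[OF p, of x "- t" k] by (simp add: v_def)
    \<comment> \<open>A translation by \<open>s v\<close> moves the shift from \<open>g'\<close> to \<open>\<phi>\<close>; the summand \<open>s 0\<close> gives both factors the form used for integrability on the product space.\<close>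
    have iI: "(\<lambda>s. \<integral>x. indicator {0..1::real} s * (g' (x + s *\<^sub>R v) * \<phi> (x + s *\<^sub>R 0)) \<partial>lborel)
        = (\<lambda>s. indicator {0..1} s * (\<integral>x. g' x * \<phi> (x + s *\<^sub>R (- v)) \<partial>lborel))"
    proof
      fix s :: real
      have "(\<integral>x. g' (x + s *\<^sub>R v) * \<phi> (x + s *\<^sub>R 0) \<partial>lborel) =
          (\<integral>x. g' (x + s *\<^sub>R v) * \<phi> ((x + s *\<^sub>R v) + s *\<^sub>R (- v)) \<partial>lborel)" by simp
      also have "\<dots> = (\<integral>x. g' x * \<phi> (x + s *\<^sub>R (- v)) \<partial>lborel)"
        by (rule lborel_integral_shift[of "\<lambda>x. g' x * \<phi> (x + s *\<^sub>R (- v))"]) simp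
      finally show "(\<integral>x. indicator {0..1::real} s * (g' (x + s *\<^sub>R v) * \<phi> (x + s *\<^sub>R 0)) \<partial>lborel)
        = indicator {0..1} s * (\<integral>x. g' x * \<phi> (x + s *\<^sub>R (- v)) \<partial>lborel)" by simp
    qed
    have G1: "(\<integral>x. G x * \<phi> x \<partial>lborel) = (\<integral>s. indicator {0..1} s * (\<integral>x. g' x * \<phi> (x + s *\<^sub>R (- v)) \<partial>lborel) \<partial>lborel)"
    proof -
      have "(\<integral>x. G x * \<phi> x \<partial>lborel) = (\<integral>x. (\<integral>s. indicator {0..1} s * (g' (x + s *\<^sub>R v) * \<phi> (x + s *\<^sub>R 0)) \<partial>lborel) \<partial>lborel)"
        unfolding G_def by (simp add: mult.assoc[symmetric])
      also have "\<dots> = (\<integral>s. (\<integral>x. indicator {0..1} s * (g' (x + s *\<^sub>R v) * \<phi> (x + s *\<^sub>R 0)) \<partial>lborel) \<partial>lborel)"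
        by (rule lborel_pair.Fubini_integral[OF integrable_segments_mult[OF g' pm B], symmetric])
      finally show ?thesis unfolding iI .
    qed
    have "(\<integral>x. (f' (x + v) - f' x) * \<phi> x \<partial>lborel) = (\<integral>x. f' (x + v) * \<phi> ((x + v) + - v) \<partial>lborel) - (\<integral>x. f' x * \<phi> x \<partial>lborel)"
      using pi[OF lborel_integrable_shift[OF f', of v]] pi[OF f'] by (simp add: left_diff_distrib)
    also have "(\<integral>x. f' (x + v) * \<phi> ((x + v) + - v) \<partial>lborel) = (\<integral>x. f' x * \<phi> (x + - v) \<partial>lborel)"
      by (rule lborel_integral_shift[of "\<lambda>x. f' x * \<phi> (x + - v)"]) simp
    also have "(\<integral>x. f' x * \<phi> (x + - v) \<partial>lborel) - (\<integral>x. f' x * \<phi> x \<partial>lborel) =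
        (\<integral>x. f' x * (\<phi> (x + - v) - \<phi> x) \<partial>lborel)"
    proof -
      have "integrable lborel (\<lambda>x. f' (x + v) * \<phi> x)" by (rule pi[OF lborel_integrable_shift[OF f']])
      from lborel_integrable_shift[OF this, of "- v"] have "integrable lborel (\<lambda>x. f' x * \<phi> (x + - v))" by simp
      then show ?thesis using pi[OF f'] by (simp add: right_diff_distrib)
    qed
    also have "\<dots> = (\<integral>x. (\<integral>s. indicator {0..1} s * (f' (x + s *\<^sub>R 0) * (- t * partial k \<phi> (x + s *\<^sub>R (- v)))) \<partial>lborel) \<partial>lborel)"
      unfolding inc by (simp flip: integral_mult_right_zero add: mult.left_commute del: integral_mult_right_zero integral_mult_left_zero)
    also have "\<dots> = (\<integral>s. (\<integral>x. indicator {0..1} s * (f' (x + s *\<^sub>R 0) * (- t * partial k \<phi> (x + s *\<^sub>R (- v)))) \<partial>lborel) \<partial>lborel)"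
    proof (rule lborel_pair.Fubini_integral[OF integrable_segments_mult[OF f', of "\<lambda>x. - t * partial k \<phi> x" "\<bar>t\<bar> * B'"], symmetric])
      show "(\<lambda>x. - t * partial k \<phi> x) \<in> borel_measurable borel" by simp
      show "\<bar>- t * partial k \<phi> x\<bar> \<le> \<bar>t\<bar> * B'" for x using B'[of x] by (simp add: abs_mult mult_left_mono)
    qed
    also have "\<dots> = (\<integral>s. t * (indicator {0..1} s * (\<integral>x. g' x * \<phi> (x + s *\<^sub>R (- v)) \<partial>lborel)) \<partial>lborel)"
    proof (rule Bochner_Integration.integral_cong[OF refl])
      fix s :: real
      have "(\<integral>x. indicator {0..1} s * (f' (x + s *\<^sub>R 0) * (- t * partial k \<phi> (x + s *\<^sub>R (- v)))) \<partial>lborel) =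
        (\<integral>x. (- t * indicator {0..1} s) * (f' x * partial k \<phi> (x + s *\<^sub>R (- v))) \<partial>lborel)"
        by (intro Bochner_Integration.integral_cong) (auto simp: algebra_simps)
      also have "\<dots> = (- t * indicator {0..1} s) * (\<integral>x. f' x * partial k \<phi> (x + s *\<^sub>R (- v)) \<partial>lborel)"
        by (rule integral_mult_right_zero)
      also have "\<dots> = t * (indicator {0..1} s * (\<integral>x. g' x * \<phi> (x + s *\<^sub>R (- v)) \<partial>lborel))"
        using shift[of s] by (cases "s \<in> {0..1}") auto
      finally show "(\<integral>x. indicator {0..1} s * (f' (x + s *\<^sub>R 0) * (- t * partial k \<phi> (x + s *\<^sub>R (- v)))) \<partial>lborel) =
         t * (indicator {0..1} s * (\<integral>x. g' x * \<phi> (x + s *\<^sub>R (- v)) \<partial>lborel))" .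
    qed
    also have "\<dots> = t * (\<integral>x. G x * \<phi> x \<partial>lborel)" unfolding G1 by (rule integral_mult_right_zero)
    finally have main: "(\<integral>x. (f' (x + v) - f' x) * \<phi> x \<partial>lborel) = t * (\<integral>x. G x * \<phi> x \<partial>lborel)" .
    have "(\<integral>x. h x * \<phi> x \<partial>lebesgue) = (\<integral>x. h x * \<phi> x \<partial>lborel)" by (rule integral_completion) simp
    also have "\<dots> = (\<integral>x. (f' (x + v) - f' x) * \<phi> x - t * (G x * \<phi> x) \<partial>lborel)"
      unfolding h_def by (intro Bochner_Integration.integral_cong) (auto simp: algebra_simps)
    also have "\<dots> = (\<integral>x. (f' (x + v) - f' x) * \<phi> x \<partial>lborel) - (\<integral>x. t * (G x * \<phi> x) \<partial>lborel)"
      using lborel_integrable_shift[OF f', of v] f' Gi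
      by (intro Bochner_Integration.integral_diff pi integrable_mult_right) auto
    finally show ?thesis using main by simp
  qed
  moreover have "locally_integrable (ball x0 r) h"
  proof -
    have "integrable lebesgue h" using hi by (simp add: integrable_completion)
    then show ?thesis
      by (intro locally_integrable_imp_integrable)
         (unfold set_integrable_def, rule integrable_mult_indicator, auto)
  qed
  ultimately have "AE x in lebesgue. x \<in> ball x0 r \<longrightarrow> h x = 0"
    by (intro fundamental_lemma_calculus_of_variations) auto
  then show ?thesis unfolding AE_completion_iff
    by eventually_elim (auto simp: h_def G_def v_def)
qed

text \<open>By Fubini the \<open>L\<^sup>1\<close> distance is at most the mean over \<open>s\<close> of the distances between \<open>g\<close> and its translates by \<open>s v\<^sub>n\<close>;
these tend to 0 for each \<open>s\<close> and are bounded by \<open>2 \<parallel>g\<parallel>\<close>.\<close>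

lemma segment_average_L1:
  fixes g :: "'a::euclidean_space \<Rightarrow> real"
  assumes g: "integrable lborel g" and v: "v \<longlonglongrightarrow> 0"
  shows "integrable lborel (\<lambda>x. (\<integral>s. indicator {0..1} s * g (x + s *\<^sub>R v n) \<partial>lborel) - g x)"
    and "(\<lambda>n. \<integral>x. \<bar>(\<integral>s. indicator {0..1} s * g (x + s *\<^sub>R v n) \<partial>lborel) - g x\<bar> \<partial>lborel) \<longlonglongrightarrow> 0"
proof -
  have gm[measurable]: "g \<in> borel_measurable borel" using g by auto
  let ?A = "\<lambda>n x. \<integral>s. indicator {0..1} s * g (x + s *\<^sub>R v n) \<partial>lborel"
  have i: "integrable lborel (?A n)" for n
    by (rule lborel_pair.integrable_fst[OF integrable_segments[OF g]])
  show 1: "integrable lborel (\<lambda>x. ?A n x - g x)" for n using i[of n] g by auto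
  have d: "integrable (lborel \<Otimes>\<^sub>M lborel) (\<lambda>(x, s). indicator {0..1} s * \<bar>g (x + s *\<^sub>R v n) - g x\<bar>)" for n
  proof -
    have "integrable (lborel \<Otimes>\<^sub>M lborel) (\<lambda>z. \<bar>(case z of (x, s) \<Rightarrow> indicator {0..1} s * g (x + s *\<^sub>R v n))
      - (case z of (x, s) \<Rightarrow> indicator {0..1} s * g (x + s *\<^sub>R 0))\<bar>)"
      by (intro integrable_abs Bochner_Integration.integrable_diff integrable_segments g)
    then show ?thesis
      by (rule Bochner_Integration.integrable_cong[OF refl, THEN iffD1, rotated]) (auto simp: indicator_def)
  qed
  define \<omega> where "\<omega> w = (\<integral>x. \<bar>g (x + w) - g x\<bar> \<partial>lborel)" for w
  have \<omega>_bound: "0 \<le> \<omega> w" "\<omega> w \<le> 2 * (\<integral>x. \<bar>g x\<bar> \<partial>lborel)" for w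
  proof -
    have gw: "integrable lborel (\<lambda>x. g (x + w))" by (rule lborel_integrable_shift[OF g])
    show "0 \<le> \<omega> w" by (simp add: \<omega>_def)
    have "\<omega> w \<le> (\<integral>x. \<bar>g (x + w)\<bar> + \<bar>g x\<bar> \<partial>lborel)"
      unfolding \<omega>_def using g gw by (intro integral_mono Bochner_Integration.integrable_add integrable_abs
          Bochner_Integration.integrable_diff) auto
    also have "\<dots> = (\<integral>x. \<bar>g (x + w)\<bar> \<partial>lborel) + (\<integral>x. \<bar>g x\<bar> \<partial>lborel)" using g gw by simp
    also have "(\<integral>x. \<bar>g (x + w)\<bar> \<partial>lborel) = (\<integral>x. \<bar>g x\<bar> \<partial>lborel)"
      by (rule lborel_integral_shift[of "\<lambda>x. \<bar>g x\<bar>"]) simp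
    finally show "\<omega> w \<le> 2 * (\<integral>x. \<bar>g x\<bar> \<partial>lborel)" by simp
  qed
  have b: "(\<integral>x. \<bar>?A n x - g x\<bar> \<partial>lborel) \<le> (\<integral>s. indicator {0..1} s * \<omega> (s *\<^sub>R v n) \<partial>lborel)" for n
  proof -
    have "(\<integral>x. \<bar>?A n x - g x\<bar> \<partial>lborel) \<le> (\<integral>x. (\<integral>s. indicator {0..1} s * \<bar>g (x + s *\<^sub>R v n) - g x\<bar> \<partial>lborel) \<partial>lborel)"
    proof (rule integral_mono_AE)
      show "integrable lborel (\<lambda>x. \<bar>?A n x - g x\<bar>)" using 1[of n] by simp
      show "integrable lborel (\<lambda>x. \<integral>s. indicator {0..1} s * \<bar>g (x + s *\<^sub>R v n) - g x\<bar> \<partial>lborel)"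
        by (rule lborel_pair.integrable_fst[OF d])
      show "AE x in lborel. \<bar>?A n x - g x\<bar> \<le> (\<integral>s. indicator {0..1} s * \<bar>g (x + s *\<^sub>R v n) - g x\<bar> \<partial>lborel)"
        using lborel_pair.AE_integrable_fst[OF integrable_segments[OF g, of "v n"]]
      proof eventually_elim
        case (elim x)
        have c: "integrable lborel (\<lambda>s. indicator {0..1::real} s * g x)" by simp
        have "?A n x - g x = ?A n x - (\<integral>s. indicator {0..1::real} s * g x \<partial>lborel)" by simp
        also have "\<dots> = (\<integral>s. indicator {0..1} s * g (x + s *\<^sub>R v n) - indicator {0..1::real} s * g x \<partial>lborel)"
          using elim c by (intro Bochner_Integration.integral_diff[symmetric]) auto
        also have "\<bar>\<dots>\<bar> \<le> (\<integral>s. \<bar>indicator {0..1} s * g (x + s *\<^sub>R v n) - indicator {0..1::real} s * g x\<bar> \<partial>lborel)"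
          by (rule integral_abs_bound)
        also have "\<dots> = (\<integral>s. indicator {0..1} s * \<bar>g (x + s *\<^sub>R v n) - g x\<bar> \<partial>lborel)"
          by (intro Bochner_Integration.integral_cong) (auto simp: indicator_def)
        finally show ?case .
      qed
    qed
    also have "\<dots> = (\<integral>s. (\<integral>x. indicator {0..1} s * \<bar>g (x + s *\<^sub>R v n) - g x\<bar> \<partial>lborel) \<partial>lborel)"
      by (rule lborel_pair.Fubini_integral[OF d, symmetric])
    finally show ?thesis by (simp add: \<omega>_def)
  qed
  have \<omega>m: "(\<lambda>s. indicator {0..1::real} s * \<omega> (s *\<^sub>R v n)) \<in> borel_measurable lborel" for n
    using borel_measurable_integrable[OF lborel_pair.integrable_snd[OF d, of n]] by (simp add: \<omega>_def)
  have "(\<lambda>n. \<integral>s. indicator {0..1} s * \<omega> (s *\<^sub>R v n) \<partial>lborel) \<longlonglongrightarrow> (\<integral>s. 0 \<partial>(lborel :: real measure))"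
  proof (rule integral_dominated_convergence[where w = "\<lambda>s. indicator {0..1::real} s * (2 * (\<integral>x. \<bar>g x\<bar> \<partial>lborel))"])
    show "AE s in lborel. (\<lambda>n. indicator {0..1::real} s * \<omega> (s *\<^sub>R v n)) \<longlonglongrightarrow> 0"
    proof (rule AE_I2)
      fix s :: real
      have "(\<lambda>n. s *\<^sub>R v n) \<longlonglongrightarrow> s *\<^sub>R 0" by (intro tendsto_intros v)
      then have "(\<lambda>n. \<omega> (s *\<^sub>R v n)) \<longlonglongrightarrow> 0" unfolding \<omega>_def by (intro translation_L1[OF g]) simp
      then show "(\<lambda>n. indicator {0..1::real} s * \<omega> (s *\<^sub>R v n)) \<longlonglongrightarrow> 0" by (rule tendsto_mult_right_zero)
    qed
    show "AE s in lborel. norm (indicator {0..1::real} s * \<omega> (s *\<^sub>R v n)) \<le> indicator {0..1::real} s * (2 * (\<integral>x. \<bar>g x\<bar> \<partial>lborel))" for n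
      using \<omega>_bound by (intro AE_I2) (auto simp: indicator_def)
  qed (use \<omega>m in auto)
  then have l: "(\<lambda>n. \<integral>s. indicator {0..1} s * \<omega> (s *\<^sub>R v n) \<partial>lborel) \<longlonglongrightarrow> 0" by simp
  show "(\<lambda>n. \<integral>x. \<bar>?A n x - g x\<bar> \<partial>lborel) \<longlonglongrightarrow> 0"
    by (rule tendsto_sandwich[OF _ _ tendsto_const l]) (auto intro: b always_eventually)
qed

text \<open>The errors of all the functions are added before the almost everywhere convergent subsequence is chosen; so a single sequence of
step lengths works for the whole family.\<close>

lemma difference_quotients_converge:
  fixes \<Omega> :: "(real ^ 'n::finite) set" and f g :: "'j \<Rightarrow> real ^ 'n \<Rightarrow> real"
  assumes J: "finite J" and w: "\<And>j. j \<in> J \<Longrightarrow> has_weak_deriv \<Omega> [k] (f j) (g j)"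
    and r: "r > 0" "cball x0 (2 * r) \<subseteq> \<Omega>"
  obtains t :: "nat \<Rightarrow> real" where "\<And>n. t n \<noteq> 0" "\<And>n. \<bar>t n\<bar> \<le> r" "t \<longlonglongrightarrow> 0"
    "AE x in lebesgue. x \<in> ball x0 r \<longrightarrow>
      (\<forall>j\<in>J. (\<lambda>n. (f j (x + t n *\<^sub>R axis k 1) - f j x) / t n) \<longlonglongrightarrow> g j x)"
proof -
  let ?C = "cball x0 (2 * r)" and ?e = "axis k 1 :: real ^ 'n"
  have rep: "\<exists>q'. integrable lborel q' \<and> (AE x in lborel. x \<in> ?C \<longrightarrow> q x = q' x) \<and>
      (\<forall>\<phi> \<in> borel_measurable borel. (\<integral>x. (indicator ?C x * q x) * \<phi> x \<partial>lebesgue) = (\<integral>x. q' x * \<phi> x \<partial>lborel))"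
    if q: "locally_integrable \<Omega> q" for q
  proof -
    have "integrable lebesgue (\<lambda>x. indicator ?C x * q x)"
      using q r unfolding locally_integrable_def set_integrable_def by auto
    then obtain q' where "integrable lborel q'" and ae: "AE x in lborel. indicator ?C x * q x = q' x"
      "\<And>\<phi>. \<phi> \<in> borel_measurable borel \<Longrightarrow> (\<integral>x. (indicator ?C x * q x) * \<phi> x \<partial>lebesgue) = (\<integral>x. q' x * \<phi> x \<partial>lborel)"
      by (rule integrable_lebesgue_borel_rep) (rule that)
    moreover have "AE x in lborel. x \<in> ?C \<longrightarrow> q x = q' x"
      using ae(1) by eventually_elim (auto simp: indicator_def)
    ultimately show ?thesis by blast
  qed
  have lf: "locally_integrable \<Omega> (f j)" and lg: "locally_integrable \<Omega> (g j)" if "j \<in> J" for j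
    using w[OF that] by (auto simp: has_weak_deriv_iff)
  define R where "R q q' \<longleftrightarrow> integrable lborel q' \<and> (AE x in lborel. x \<in> ?C \<longrightarrow> q x = q' x) \<and>
      (\<forall>\<phi> \<in> borel_measurable borel. (\<integral>x. (indicator ?C x * q x) * \<phi> x \<partial>lebesgue) = (\<integral>x. q' x * \<phi> x \<partial>lborel))"
    for q q' :: "real ^ 'n \<Rightarrow> real"
  have "\<exists>f'. \<forall>j\<in>J. R (f j) (f' j)" using rep[OF lf] unfolding R_def by (intro bchoice) blast
  then obtain f' where f': "\<And>j. j \<in> J \<Longrightarrow> R (f j) (f' j)" by blast
  have "\<exists>g'. \<forall>j\<in>J. R (g j) (g' j)" using rep[OF lg] unfolding R_def by (intro bchoice) blast
  then obtain g' where g': "\<And>j. j \<in> J \<Longrightarrow> R (g j) (g' j)" by blast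
  define T where "T n = r * inverse (real (Suc n))" for n
  have T: "T n > 0" "T n \<le> r" for n
    using r by (auto simp: T_def mult_le_cancel_left2 inverse_le_1_iff)
  have T0: "T \<longlonglongrightarrow> 0" unfolding T_def
    using tendsto_mult[OF tendsto_const LIMSEQ_inverse_real_of_nat, of r] by simp
  have v0: "(\<lambda>n. T n *\<^sub>R ?e) \<longlonglongrightarrow> 0" using tendsto_scaleR[OF T0 tendsto_const, of ?e] by simp
  define E where "E j n x = (\<integral>s. indicator {0..1} s * g' j (x + s *\<^sub>R (T n *\<^sub>R ?e)) \<partial>lborel) - g' j x" for j n x
  have Ei: "integrable lborel (E j n)" and E0: "(\<lambda>n. \<integral>x. \<bar>E j n x\<bar> \<partial>lborel) \<longlonglongrightarrow> 0" if "j \<in> J" for j n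
    unfolding E_def using segment_average_L1[OF _ v0, of "g' j"] g'[OF that] by (auto simp: R_def)
  have Si: "integrable lborel (\<lambda>x. \<Sum>j\<in>J. \<bar>E j n x\<bar>)" for n
    using Ei by auto
  have "(\<lambda>n. \<Sum>j\<in>J. \<integral>x. \<bar>E j n x\<bar> \<partial>lborel) \<longlonglongrightarrow> (\<Sum>j\<in>J. 0)"
    by (intro tendsto_sum E0)
  then have "(\<lambda>n. \<integral>x. norm (\<Sum>j\<in>J. \<bar>E j n x\<bar>) \<partial>lborel) \<longlonglongrightarrow> 0"
    using Ei by (subst (asm) Bochner_Integration.integral_sum[symmetric]) (auto simp: sum_nonneg)
  from tendsto_L1_AE_subseq[OF Si this] obtain \<rho> where \<rho>: "strict_mono \<rho>"
    and S0: "AE x in lborel. (\<lambda>n. \<Sum>j\<in>J. \<bar>E j (\<rho> n) x\<bar>) \<longlonglongrightarrow> 0" by blast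
  define t where "t n = T (\<rho> n)" for n
  have t: "t n > 0" "t n \<le> r" for n using T by (auto simp: t_def)
  have inc: "AE x in lborel. \<forall>n. x \<in> ball x0 r \<longrightarrow> f' j (x + t n *\<^sub>R ?e) - f' j x = t n * (E j (\<rho> n) x + g' j x)"
    if j: "j \<in> J" for j
  proof (subst AE_all_countable, rule allI)
    fix n
    have "AE x in lborel. x \<in> ball x0 r \<longrightarrow>
        f' j (x + t n *\<^sub>R ?e) - f' j x = t n * (\<integral>s. indicator {0..1} s * g' j (x + s *\<^sub>R (t n *\<^sub>R ?e)) \<partial>lborel)"
      using weak_deriv_increment[OF w[OF j] r(2), of "t n" "f' j" "g' j"] f'[OF j] g'[OF j] t[of n]
      by (auto simp: R_def)
    then show "AE x in lborel. x \<in> ball x0 r \<longrightarrow> f' j (x + t n *\<^sub>R ?e) - f' j x = t n * (E j (\<rho> n) x + g' j x)"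
      by (simp add: E_def t_def)
  qed
  have sh: "AE x in lborel. \<forall>n. x + t n *\<^sub>R ?e \<in> ?C \<longrightarrow> f j (x + t n *\<^sub>R ?e) = f' j (x + t n *\<^sub>R ?e)"
    if j: "j \<in> J" for j
  proof -
    have "AE x in lborel. x \<in> ?C \<longrightarrow> f j x = f' j x" using f'[OF j] by (simp add: R_def)
    from lborel_AE_shift[OF this] show ?thesis unfolding AE_all_countable by blast
  qed
  have ff: "AE x in lborel. x \<in> ?C \<longrightarrow> f j x = f' j x" "AE x in lborel. x \<in> ?C \<longrightarrow> g j x = g' j x" if "j \<in> J" for j
    using f'[OF that] g'[OF that] by (auto simp: R_def)
  have "AE x in lborel. x \<in> ball x0 r \<longrightarrow> (\<lambda>n. (f j (x + t n *\<^sub>R ?e) - f j x) / t n) \<longlonglongrightarrow> g j x"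
    if j: "j \<in> J" for j
    using S0 inc[OF j] sh[OF j] ff[OF j]
  proof eventually_elim
    case (elim x)
    show ?case
    proof
      assume x: "x \<in> ball x0 r"
      then have xC: "x \<in> ?C" using r by auto
      have xn: "x + t n *\<^sub>R ?e \<in> ?C" for n
      proof -
        have "norm (x0 - (x + t n *\<^sub>R ?e)) \<le> norm (x0 - x) + norm (t n *\<^sub>R ?e)"
          using norm_triangle_ineq4[of "x0 - x" "t n *\<^sub>R ?e"] by (simp add: algebra_simps)
        then show ?thesis using x t[of n] by (simp add: dist_norm)
      qed
      have eq: "(f j (x + t n *\<^sub>R ?e) - f j x) / t n = E j (\<rho> n) x + g j x" for n
        using elim xC xn[of n] x t(1)[of n] by simp
      have "(\<lambda>n. \<bar>E j (\<rho> n) x\<bar>) \<longlonglongrightarrow> 0"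
        by (rule tendsto_sandwich[OF _ _ tendsto_const elim(1)])
           (auto intro!: always_eventually member_le_sum[OF j, of "\<lambda>j. \<bar>E j (\<rho> _) x\<bar>"] simp: J)
      then have "(\<lambda>n. E j (\<rho> n) x) \<longlonglongrightarrow> 0" by (rule tendsto_rabs_zero_cancel)
      from tendsto_add[OF this tendsto_const, of "g j x"]
      show "(\<lambda>n. (f j (x + t n *\<^sub>R ?e) - f j x) / t n) \<longlonglongrightarrow> g j x" by (simp add: eq)
    qed
  qed
  then have "AE x in lborel. \<forall>j\<in>J. x \<in> ball x0 r \<longrightarrow> (\<lambda>n. (f j (x + t n *\<^sub>R ?e) - f j x) / t n) \<longlonglongrightarrow> g j x"
    using J by (subst AE_ball_countable) (auto intro: countable_finite)
  then have "AE x in lebesgue. x \<in> ball x0 r \<longrightarrow>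
      (\<forall>j\<in>J. (\<lambda>n. (f j (x + t n *\<^sub>R ?e) - f j x) / t n) \<longlonglongrightarrow> g j x)"
    unfolding AE_completion_iff by eventually_elim blast
  moreover have "t \<longlonglongrightarrow> 0" unfolding t_def using LIMSEQ_subseq_LIMSEQ[OF T0 \<rho>] by (simp add: o_def)
  moreover have "t n \<noteq> 0" "\<bar>t n\<bar> \<le> r" for n using t[of n] by auto
  ultimately show ?thesis using that[of t] by blast
qed

text \<open>Products such as \<open>a b\<close> and \<open>a' b\<close> need not be locally integrable, so the identity is derived pointwise. It holds
at every point where the four difference quotients converge along the same sequence \<open>t\<^sub>n\<close> and where \<open>a b = c d\<close> holds at the point itself and
at its countably many translates by \<open>t\<^sub>n e\<^sub>k\<close>.\<close>

lemma formal_product_rule: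
  fixes \<Omega> :: "(real ^ 'n::finite) set"
  assumes "open \<Omega>"
    and w: "has_weak_deriv \<Omega> [k] a a'" "has_weak_deriv \<Omega> [k] b b'"
      "has_weak_deriv \<Omega> [k] c c'" "has_weak_deriv \<Omega> [k] d d'"
    and eq: "AE x in lebesgue. x \<in> \<Omega> \<longrightarrow> a x * b x = c x * d x"
  shows "AE x in lebesgue. x \<in> \<Omega> \<longrightarrow> a' x * b x + a x * b' x = c' x * d x + c x * d' x"
proof (rule AE_locally)
  fix x0 assume "x0 \<in> \<Omega>"
  then obtain r0 where "r0 > 0" "cball x0 r0 \<subseteq> \<Omega>" using \<open>open \<Omega>\<close> open_contains_cball by blast
  then obtain r where r: "r > 0" "cball x0 (2 * r) \<subseteq> \<Omega>" by (metis half_gt_zero mult.commute nonzero_eq_divide_eq zero_neq_numeral)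
  let ?e = "axis k 1 :: real ^ 'n"
  let ?f = "(!) [a, b, c, d]" and ?g = "(!) [a', b', c', d']"
  have "has_weak_deriv \<Omega> [k] (?f j) (?g j)" if "j \<in> {..<4}" for j :: nat
  proof -
    have "j = 0 \<or> j = 1 \<or> j = 2 \<or> j = 3" using that by auto
    then consider "j = 0" | "j = 1" | "j = 2" | "j = 3" by blast
    then show ?thesis by cases (simp_all add: w)
  qed
  then obtain t where t: "\<And>n. t n \<noteq> 0" "\<And>n. \<bar>t n\<bar> \<le> r" "t \<longlonglongrightarrow> 0"
    and l: "AE x in lebesgue. x \<in> ball x0 r \<longrightarrow>
      (\<forall>j\<in>{..<4}. (\<lambda>n. (?f j (x + t n *\<^sub>R ?e) - ?f j x) / t n) \<longlonglongrightarrow> ?g j x)"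
    using difference_quotients_converge[OF finite_lessThan _ r, of 4 k ?f ?g] by blast
  have eqn: "AE x in lebesgue. \<forall>n. x + t n *\<^sub>R ?e \<in> \<Omega> \<longrightarrow>
      a (x + t n *\<^sub>R ?e) * b (x + t n *\<^sub>R ?e) = c (x + t n *\<^sub>R ?e) * d (x + t n *\<^sub>R ?e)"
    using lborel_AE_shift[OF eq[unfolded AE_completion_iff]]
    unfolding AE_completion_iff AE_all_countable by blast
  have "AE x in lebesgue. x \<in> ball x0 r \<longrightarrow> a' x * b x + a x * b' x = c' x * d x + c x * d' x"
    using l eqn eq
  proof eventually_elim
    case (elim x)
    show ?case
    proof
      assume x: "x \<in> ball x0 r"
      have xn: "x + t n *\<^sub>R ?e \<in> \<Omega>" for n
      proof -
        have "norm (x0 - (x + t n *\<^sub>R ?e)) \<le> norm (x0 - x) + norm (t n *\<^sub>R ?e)"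
          using norm_triangle_ineq4[of "x0 - x" "t n *\<^sub>R ?e"] by (simp add: algebra_simps)
        then have "x + t n *\<^sub>R ?e \<in> cball x0 (2 * r)" using x t(2)[of n] by (simp add: dist_norm)
        then show ?thesis using r by blast
      qed
      have x\<Omega>: "x \<in> \<Omega>" using x r by (auto simp: subset_iff)
      have q: "(\<lambda>n. (?f j (x + t n *\<^sub>R ?e) - ?f j x) / t n) \<longlonglongrightarrow> ?g j x" if "j < 4" for j
        using elim(1) x that by auto
      have Q: "(\<lambda>n. (a (x + t n *\<^sub>R ?e) - a x) / t n) \<longlonglongrightarrow> a' x" "(\<lambda>n. (b (x + t n *\<^sub>R ?e) - b x) / t n) \<longlonglongrightarrow> b' x"
        "(\<lambda>n. (c (x + t n *\<^sub>R ?e) - c x) / t n) \<longlonglongrightarrow> c' x" "(\<lambda>n. (d (x + t n *\<^sub>R ?e) - d x) / t n) \<longlonglongrightarrow> d' x"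
        using q[of 0] q[of 1] q[of 2] q[of 3] by simp_all
      have prod: "(\<lambda>n. (p (x + t n *\<^sub>R ?e) * q (x + t n *\<^sub>R ?e) - p x * q x) / t n) \<longlonglongrightarrow> p' * q x + p x * q'"
        if p: "(\<lambda>n. (p (x + t n *\<^sub>R ?e) - p x) / t n) \<longlonglongrightarrow> p'" and q: "(\<lambda>n. (q (x + t n *\<^sub>R ?e) - q x) / t n) \<longlonglongrightarrow> q'"
        for p q :: "real ^ 'n \<Rightarrow> real" and p' q'
      proof -
        have "(\<lambda>n. (q (x + t n *\<^sub>R ?e) - q x) / t n * t n + q x) \<longlonglongrightarrow> q' * 0 + q x"
          by (intro tendsto_intros q t)
        then have "(\<lambda>n. q (x + t n *\<^sub>R ?e)) \<longlonglongrightarrow> q x" using t(1) by simp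
        then have "(\<lambda>n. (p (x + t n *\<^sub>R ?e) - p x) / t n * q (x + t n *\<^sub>R ?e) +
            p x * ((q (x + t n *\<^sub>R ?e) - q x) / t n)) \<longlonglongrightarrow> p' * q x + p x * q'"
          by (intro tendsto_intros p q)
        moreover have "(p (x + t n *\<^sub>R ?e) - p x) / t n * q (x + t n *\<^sub>R ?e) +
            p x * ((q (x + t n *\<^sub>R ?e) - q x) / t n) =
            (p (x + t n *\<^sub>R ?e) * q (x + t n *\<^sub>R ?e) - p x * q x) / t n" for n
          by (simp add: left_diff_distrib right_diff_distrib diff_divide_distrib)
        ultimately show ?thesis by simp
      qed
      have "(a (x + t n *\<^sub>R ?e) * b (x + t n *\<^sub>R ?e) - a x * b x) / t n =
          (c (x + t n *\<^sub>R ?e) * d (x + t n *\<^sub>R ?e) - c x * d x) / t n" for n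
        using elim(2,3) xn x\<Omega> by simp
      with prod[OF Q(1,2)] prod[OF Q(3,4)]
      show "a' x * b x + a x * b' x = c' x * d x + c x * d' x" by (auto intro: LIMSEQ_unique)
    qed
  qed
  then show "\<exists>U. open U \<and> x0 \<in> U \<and> (AE x in lebesgue. x \<in> U \<longrightarrow> a' x * b x + a x * b' x = c' x * d x + c x * d' x)"
    using r by (intro exI[of _ "ball x0 r"]) auto
qed

section \<open>Sobolev functions with zero boundary values\<close>

text \<open>A step of length \<open>3 T\<close> exceeds the diameter, at most \<open>2 T\<close>, of \<open>\<Omega>\<close>. It leads from any point of \<open>\<Omega>\<close> to a zero of
\<open>\<phi>\<close>, so \<open>\<phi>\<close> is bounded pointwise by the integral of its derivative along this segment.\<close>

lemma test_function_poincare: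
  fixes \<Omega> :: "(real ^ 'n::finite) set"
  assumes p: "\<phi> \<in> test_functions \<Omega>" and T: "\<And>x. x \<in> \<Omega> \<Longrightarrow> norm x \<le> T" "T > 0"
  shows "(\<integral>x. \<bar>\<phi> x\<bar> \<partial>lebesgue) \<le> 3 * T * (\<integral>x. \<bar>partial k \<phi> x\<bar> \<partial>lebesgue)"
proof -
  let ?v = "(3 * T) *\<^sub>R axis k 1 :: real ^ 'n"
  note [measurable] = test_function_measurable[OF p] test_function_measurable[OF test_function_partial[OF p, of k]]
  have pi: "integrable lborel \<phi>" and qi: "integrable lborel (partial k \<phi>)"
    using test_function_integrable[OF p] test_function_integrable[OF test_function_partial[OF p]] by auto
  have b: "\<bar>\<phi> x\<bar> \<le> (\<integral>s. indicator {0..1} s * (3 * T * \<bar>partial k \<phi> (x + s *\<^sub>R ?v)\<bar>) \<partial>lborel)" for x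
  proof (cases "x \<in> \<Omega>")
    case True
    have "x + ?v \<notin> \<Omega>"
    proof
      assume "x + ?v \<in> \<Omega>"
      then have "norm ?v \<le> 2 * T" using T(1)[of "x + ?v"] T(1)[OF True] norm_triangle_ineq4[of "x + ?v" x] by simp
      then show False using T(2) by simp
    qed
    then have "\<bar>\<phi> x\<bar> = \<bar>\<phi> (x + ?v) - \<phi> x\<bar>" using test_function_zero_outside[OF p] by simp
    also have "\<dots> = \<bar>\<integral>s. indicator {0..1} s * (3 * T * partial k \<phi> (x + s *\<^sub>R ?v)) \<partial>lborel\<bar>"
      unfolding test_function_increment[OF p] ..
    also have "\<dots> \<le> (\<integral>s. \<bar>indicator {0..1} s * (3 * T * partial k \<phi> (x + s *\<^sub>R ?v))\<bar> \<partial>lborel)"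
      by (rule integral_abs_bound)
    also have "\<dots> = (\<integral>s. indicator {0..1} s * (3 * T * \<bar>partial k \<phi> (x + s *\<^sub>R ?v)\<bar>) \<partial>lborel)"
      using T(2) by (intro Bochner_Integration.integral_cong) (auto simp: indicator_def abs_mult)
    finally show ?thesis .
  next
    case False
    then show ?thesis using test_function_zero_outside[OF p] T(2) by (auto intro!: integral_nonneg_AE)
  qed
  have ai: "integrable lborel (\<lambda>x. 3 * T * \<bar>partial k \<phi> x\<bar>)" using qi by simp
  note F = integrable_segments[OF ai, of ?v]
  have "(\<integral>x. \<bar>\<phi> x\<bar> \<partial>lborel) \<le> (\<integral>x. (\<integral>s. indicator {0..1} s * (3 * T * \<bar>partial k \<phi> (x + s *\<^sub>R ?v)\<bar>) \<partial>lborel) \<partial>lborel)"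
    using pi b lborel_pair.integrable_fst[OF F] by (intro integral_mono) auto
  also have "\<dots> = (\<integral>s. (\<integral>x. indicator {0..1} s * (3 * T * \<bar>partial k \<phi> (x + s *\<^sub>R ?v)\<bar>) \<partial>lborel) \<partial>lborel)"
    by (rule lborel_pair.Fubini_integral[OF F, symmetric])
  also have "\<dots> = (\<integral>s. indicator {0..1::real} s * (3 * T * (\<integral>x. \<bar>partial k \<phi> x\<bar> \<partial>lborel)) \<partial>lborel)"
    using lborel_integral_shift[of "\<lambda>x. \<bar>partial k \<phi> x\<bar>"] by simp
  also have "\<dots> = 3 * T * (\<integral>x. \<bar>partial k \<phi> x\<bar> \<partial>lborel)" by simp
  finally show ?thesis by (simp add: integral_completion)
qed

text \<open>The representatives \<open>weak_deriv\<close> are chosen without regard to measurability outside \<open>\<Omega>\<close>; completeness of Lebesgue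
measure lets integrability pass to a function known only up to a null set of \<open>\<Omega>\<close>.\<close>

lemma set_integrable_AE_cong:
  fixes f g :: "'a::euclidean_space \<Rightarrow> real"
  assumes "set_integrable lebesgue \<Omega> f" "AE x in lebesgue. x \<in> \<Omega> \<longrightarrow> f x = g x"
  shows "set_integrable lebesgue \<Omega> g"
proof -
  obtain N where N: "N \<in> null_sets lebesgue" "{x. \<not> (x \<in> \<Omega> \<longrightarrow> f x = g x)} \<subseteq> N"
    using assms(2) by (auto simp: eventually_ae_filter)
  show ?thesis
    by (rule absolutely_integrable_spike[OF assms(1), of N]) (use N in \<open>auto simp: negligible_iff_null_sets\<close>)
qed

lemma set_integral_AE_cong:
  fixes f g :: "'a::euclidean_space \<Rightarrow> real"
  assumes f: "set_integrable lebesgue \<Omega> f" and e: "AE x in lebesgue. x \<in> \<Omega> \<longrightarrow> f x = g x"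
  shows "(LINT x:\<Omega>|lebesgue. f x) = (LINT x:\<Omega>|lebesgue. g x)"
  unfolding set_lebesgue_integral_def
proof (rule integral_cong_AE)
  show "(\<lambda>x. indicator \<Omega> x *\<^sub>R f x) \<in> borel_measurable lebesgue"
    "(\<lambda>x. indicator \<Omega> x *\<^sub>R g x) \<in> borel_measurable lebesgue"
    using f set_integrable_AE_cong[OF f e] by (auto simp: set_integrable_def)
  show "AE x in lebesgue. indicator \<Omega> x *\<^sub>R f x = indicator \<Omega> x *\<^sub>R g x"
    using e by eventually_elim (auto simp: indicator_def)
qed

lemma W1_D:
  fixes \<Omega> :: "(real ^ 'n::finite) set"
  assumes "open \<Omega>" "f \<in> W1 k \<Omega>" "length \<alpha> \<le> k"
  shows "has_weak_deriv \<Omega> \<alpha> f (weak_deriv \<Omega> \<alpha> f)" "set_integrable lebesgue \<Omega> (weak_deriv \<Omega> \<alpha> f)"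
proof -
  obtain g where g: "g \<in> L1 \<Omega>" "has_weak_deriv \<Omega> \<alpha> f g" using assms unfolding W1_def by blast
  show "has_weak_deriv \<Omega> \<alpha> f (weak_deriv \<Omega> \<alpha> f)" by (rule has_weak_deriv_weak_deriv[OF g(2)])
  show "set_integrable lebesgue \<Omega> (weak_deriv \<Omega> \<alpha> f)"
  proof (rule set_integrable_AE_cong)
    show "set_integrable lebesgue \<Omega> g" using g(1) by (simp add: L1_def)
    show "AE x in lebesgue. x \<in> \<Omega> \<longrightarrow> g x = weak_deriv \<Omega> \<alpha> f x"
      using weak_deriv_AE_eq[OF assms(1) g(2)] by eventually_elim simp
  qed
qed

lemma W1_integrable:
  fixes \<Omega> :: "(real ^ 'n::finite) set"
  assumes "open \<Omega>" "f \<in> W1 k \<Omega>"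
  shows "set_integrable lebesgue \<Omega> f" "AE x in lebesgue. x \<in> \<Omega> \<longrightarrow> weak_deriv \<Omega> [] f x = f x"
proof -
  have "locally_integrable \<Omega> f" using W1_D(1)[OF assms, of "[]"] by (simp add: has_weak_deriv_iff)
  from weak_deriv_AE_eq[OF assms(1) has_weak_deriv_Nil[OF this]]
  show 1: "AE x in lebesgue. x \<in> \<Omega> \<longrightarrow> weak_deriv \<Omega> [] f x = f x" .
  show "set_integrable lebesgue \<Omega> f"
    by (rule set_integrable_AE_cong[OF W1_D(2)[OF assms, of "[]"] 1]) simp
qed

lemma W1_mono:
  assumes "k \<le> l" shows "W1 l \<Omega> \<subseteq> W1 k \<Omega>"
  unfolding W1_def using assms by (intro Collect_mono allI impI) simp

lemma W1_linear:
  assumes "f \<in> W1 k \<Omega>" "g \<in> W1 k \<Omega>"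
  shows "(\<lambda>x. c * f x + d * g x) \<in> W1 k \<Omega>"
  unfolding W1_def
proof (intro CollectI allI impI)
  fix \<alpha> :: "'a list" assume "length \<alpha> \<le> k"
  then obtain f' g' where f': "f' \<in> L1 \<Omega>" "has_weak_deriv \<Omega> \<alpha> f f'"
    and g': "g' \<in> L1 \<Omega>" "has_weak_deriv \<Omega> \<alpha> g g'"
    using assms unfolding W1_def by blast
  have "(\<lambda>x. c * f' x + d * g' x) \<in> L1 \<Omega>"
    using f'(1) g'(1) unfolding L1_def by (auto intro!: set_integral_add)
  then show "\<exists>h\<in>L1 \<Omega>. has_weak_deriv \<Omega> \<alpha> (\<lambda>x. c * f x + d * g x) h"
    using has_weak_deriv_linear[OF f'(2) g'(2), of c d] by blast
qed

lemma weak_deriv_linear: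
  fixes \<Omega> :: "(real ^ 'n::finite) set"
  assumes "open \<Omega>" "f \<in> W1 k \<Omega>" "g \<in> W1 k \<Omega>" "length \<alpha> \<le> k"
  shows "AE x in lebesgue. x \<in> \<Omega> \<longrightarrow>
    weak_deriv \<Omega> \<alpha> (\<lambda>x. c * f x + d * g x) x = c * weak_deriv \<Omega> \<alpha> f x + d * weak_deriv \<Omega> \<alpha> g x"
  using assms by (intro weak_deriv_AE_eq has_weak_deriv_linear W1_D(1)) auto

lemma test_function_W1:
  fixes \<Omega> :: "(real ^ 'n::finite) set"
  assumes "open \<Omega>" and p: "\<phi> \<in> test_functions \<Omega>"
  shows "\<phi> \<in> W1 1 \<Omega>"
proof -
  have i: "\<psi> \<in> L1 \<Omega>" if "\<psi> \<in> test_functions \<Omega>" for \<psi>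
    unfolding L1_def using \<open>open \<Omega>\<close> by (intro CollectI test_function_set_integrable[OF that]) auto
  show ?thesis
    unfolding W1_def
  proof (intro CollectI allI impI)
    fix \<alpha> :: "'n list" assume "length \<alpha> \<le> 1"
    then consider "\<alpha> = []" | k where "\<alpha> = [k]" by (cases \<alpha>) auto
    then show "\<exists>g\<in>L1 \<Omega>. has_weak_deriv \<Omega> \<alpha> \<phi> g"
    proof cases
      case 1
      have "locally_integrable \<Omega> \<phi>" using i[OF p] by (intro locally_integrable_imp_integrable) (simp add: L1_def)
      then show ?thesis using 1 i[OF p] has_weak_deriv_Nil by blast
    next
      case 2
      then show ?thesis using test_function_has_weak_deriv[OF p] i[OF test_function_partial[OF p]] by blast
    qed
  qed
qed

lemma finite_multi_indices: "finite {\<alpha> :: 'n::finite list. length \<alpha> \<le> k}"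
  using finite_lists_length_le[of "UNIV :: 'n set" k] by simp

lemma W1_norm_term:
  fixes \<Omega> :: "(real ^ 'n::finite) set"
  assumes "length \<alpha> \<le> k"
  shows "(LINT x:\<Omega>|lebesgue. \<bar>weak_deriv \<Omega> \<alpha> f x\<bar>) \<le> W1_norm k \<Omega> f"
  unfolding W1_norm_def
  by (rule member_le_sum[of \<alpha> "{\<alpha>. length \<alpha> \<le> k}" "\<lambda>\<alpha>. LINT x:\<Omega>|lebesgue. \<bar>weak_deriv \<Omega> \<alpha> f x\<bar>"])
     (use assms in \<open>auto simp: finite_multi_indices set_lebesgue_integral_def\<close>)

lemma W1_norm_mono:
  fixes \<Omega> :: "(real ^ 'n::finite) set"
  assumes "k \<le> l" shows "W1_norm k \<Omega> f \<le> W1_norm l \<Omega> f"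
  unfolding W1_norm_def
  by (rule sum_mono2) (use assms in \<open>auto simp: finite_multi_indices set_lebesgue_integral_def\<close>)

lemma W1_0_mono:
  fixes \<Omega> :: "(real ^ 'n::finite) set"
  assumes "k \<le> l" shows "W1_0 l \<Omega> \<subseteq> W1_0 k \<Omega>"
  unfolding W1_0_def using W1_mono[OF assms, of \<Omega>] W1_norm_mono[OF assms, of \<Omega>]
  by (blast intro: le_less_trans)

lemma W1_0_scale:
  fixes \<Omega> :: "(real ^ 'n::finite) set"
  assumes "open \<Omega>" and f: "f \<in> W1_0 1 \<Omega>"
  shows "(\<lambda>x. c * f x) \<in> W1_0 1 \<Omega>"
  unfolding W1_0_def
proof (intro CollectI conjI allI impI)
  have fW: "f \<in> W1 1 \<Omega>" using f by (simp add: W1_0_def)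
  show "(\<lambda>x. c * f x) \<in> W1 1 \<Omega>" using W1_linear[OF fW fW, of c 0] by simp
  fix \<epsilon> :: real assume "\<epsilon> > 0"
  then have "\<epsilon> / (\<bar>c\<bar> + 1) > 0" by simp
  then obtain \<phi> where p: "\<phi> \<in> test_functions \<Omega>" and n: "W1_norm 1 \<Omega> (\<lambda>x. f x - \<phi> x) < \<epsilon> / (\<bar>c\<bar> + 1)"
    using f unfolding W1_0_def by blast
  let ?h = "\<lambda>x. f x - \<phi> x"
  have hW: "?h \<in> W1 1 \<Omega>" using W1_linear[OF fW test_function_W1[OF \<open>open \<Omega>\<close> p], of 1 "-1"] by simp
  have "(LINT x:\<Omega>|lebesgue. \<bar>weak_deriv \<Omega> \<alpha> (\<lambda>x. c * f x - c * \<phi> x) x\<bar>) =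
      \<bar>c\<bar> * (LINT x:\<Omega>|lebesgue. \<bar>weak_deriv \<Omega> \<alpha> ?h x\<bar>)" if a: "length \<alpha> \<le> 1" for \<alpha>
  proof -
    have "AE x in lebesgue. x \<in> \<Omega> \<longrightarrow> weak_deriv \<Omega> \<alpha> (\<lambda>x. c * ?h x) x = c * weak_deriv \<Omega> \<alpha> ?h x"
      using weak_deriv_linear[OF \<open>open \<Omega>\<close> hW hW a, of c 0] by simp
    then have ae: "AE x in lebesgue. x \<in> \<Omega> \<longrightarrow> \<bar>c\<bar> * \<bar>weak_deriv \<Omega> \<alpha> ?h x\<bar> = \<bar>weak_deriv \<Omega> \<alpha> (\<lambda>x. c * f x - c * \<phi> x) x\<bar>"
      by eventually_elim (auto simp: abs_mult right_diff_distrib)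
    have "set_integrable lebesgue \<Omega> (\<lambda>x. \<bar>c\<bar> * \<bar>weak_deriv \<Omega> \<alpha> ?h x\<bar>)"
      using set_integrable_abs[OF W1_D(2)[OF \<open>open \<Omega>\<close> hW a]] by simp
    from set_integral_AE_cong[OF this ae] show ?thesis by simp
  qed
  then have "W1_norm 1 \<Omega> (\<lambda>x. c * f x - c * \<phi> x) = \<bar>c\<bar> * W1_norm 1 \<Omega> ?h"
    unfolding W1_norm_def by (simp add: sum_distrib_left)
  also have "\<dots> \<le> \<bar>c\<bar> * (\<epsilon> / (\<bar>c\<bar> + 1))" using n by (intro mult_left_mono) auto
  also have "\<dots> < \<epsilon>" using \<open>\<epsilon> > 0\<close> by (simp add: field_simps add_pos_nonneg)
  finally show "\<exists>\<psi>\<in>test_functions \<Omega>. W1_norm 1 \<Omega> (\<lambda>x. c * f x - \<psi> x) < \<epsilon>"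
    using test_function_scale[OF p, of c] by (intro bexI)
qed

text \<open>If \<open>\<phi>\<close> is close to \<open>f\<close> in the Sobolev norm, then \<open>\<partial>\<^sub>k \<phi>\<close> is small in the mean because \<open>\<partial>\<^sub>k f = 0\<close>, hence \<open>\<phi>\<close> is
small by the Poincare inequality, and so is \<open>f\<close>.\<close>

lemma W1_0_zero_gradient:
  fixes \<Omega> :: "(real ^ 'n::finite) set"
  assumes "open \<Omega>" "bounded \<Omega>" and f: "f \<in> W1_0 1 \<Omega>"
    and z: "AE x in lebesgue. x \<in> \<Omega> \<longrightarrow> weak_deriv \<Omega> [k] f x = 0"
  shows "AE x in lebesgue. x \<in> \<Omega> \<longrightarrow> f x = 0"
proof -
  obtain T where T: "T > 0" "\<And>x. x \<in> \<Omega> \<Longrightarrow> norm x \<le> T"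
    using \<open>bounded \<Omega>\<close> unfolding bounded_pos by blast
  have fW: "f \<in> W1 1 \<Omega>" using f by (simp add: W1_0_def)
  note fi = W1_integrable(1)[OF \<open>open \<Omega>\<close> fW]
  have "(LINT x:\<Omega>|lebesgue. \<bar>f x\<bar>) \<le> (1 + 3 * T) * \<epsilon>" if e: "\<epsilon> > 0" for \<epsilon>
  proof -
    obtain \<phi> where p: "\<phi> \<in> test_functions \<Omega>" and n: "W1_norm 1 \<Omega> (\<lambda>x. f x - \<phi> x) < \<epsilon>"
      using f e unfolding W1_0_def by blast
    note pW = test_function_W1[OF \<open>open \<Omega>\<close> p]
    note pi = W1_integrable(1)[OF \<open>open \<Omega>\<close> pW]
    let ?h = "\<lambda>x. f x - \<phi> x"
    have hW: "?h \<in> W1 1 \<Omega>" using W1_linear[OF fW pW, of 1 "-1"] by simp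
    have "(LINT x:\<Omega>|lebesgue. \<bar>?h x\<bar>) = (LINT x:\<Omega>|lebesgue. \<bar>weak_deriv \<Omega> [] ?h x\<bar>)"
    proof (rule set_integral_AE_cong)
      show "set_integrable lebesgue \<Omega> (\<lambda>x. \<bar>?h x\<bar>)"
        by (rule set_integrable_abs[OF W1_integrable(1)[OF \<open>open \<Omega>\<close> hW]])
      show "AE x in lebesgue. x \<in> \<Omega> \<longrightarrow> \<bar>?h x\<bar> = \<bar>weak_deriv \<Omega> [] ?h x\<bar>"
        using W1_integrable(2)[OF \<open>open \<Omega>\<close> hW] by eventually_elim simp
    qed
    also have "\<dots> \<le> \<epsilon>" using W1_norm_term[of "[]" 1 \<Omega> ?h] n by simp
    finally have 1: "(LINT x:\<Omega>|lebesgue. \<bar>?h x\<bar>) \<le> \<epsilon>" .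
    have "AE x in lebesgue. x \<in> \<Omega> \<longrightarrow> weak_deriv \<Omega> [k] ?h x = weak_deriv \<Omega> [k] f x - weak_deriv \<Omega> [k] \<phi> x"
      using weak_deriv_linear[OF \<open>open \<Omega>\<close> fW pW, of "[k]" 1 "-1"] by simp
    then have ae: "AE x in lebesgue. x \<in> \<Omega> \<longrightarrow> \<bar>weak_deriv \<Omega> [k] ?h x\<bar> = \<bar>partial k \<phi> x\<bar>"
      using z weak_deriv_AE_eq[OF \<open>open \<Omega>\<close> test_function_has_weak_deriv[OF p, of k]] by eventually_elim auto
    have "(LINT x:\<Omega>|lebesgue. \<bar>partial k \<phi> x\<bar>) = (LINT x:\<Omega>|lebesgue. \<bar>weak_deriv \<Omega> [k] ?h x\<bar>)"
      by (rule set_integral_AE_cong[OF set_integrable_abs[OF W1_D(2)[OF \<open>open \<Omega>\<close> hW]] ae, symmetric]) simp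
    also have "\<dots> \<le> \<epsilon>" using W1_norm_term[of "[k]" 1 \<Omega> ?h] n by simp
    also have "(LINT x:\<Omega>|lebesgue. \<bar>partial k \<phi> x\<bar>) = (\<integral>x. \<bar>partial k \<phi> x\<bar> \<partial>lebesgue)"
      unfolding set_lebesgue_integral_def using test_function_zero_outside[OF test_function_partial[OF p]]
      by (intro Bochner_Integration.integral_cong) (auto simp: indicator_def)
    finally have 2: "(\<integral>x. \<bar>partial k \<phi> x\<bar> \<partial>lebesgue) \<le> \<epsilon>" .
    have "(LINT x:\<Omega>|lebesgue. \<bar>\<phi> x\<bar>) = (\<integral>x. \<bar>\<phi> x\<bar> \<partial>lebesgue)"
      unfolding set_lebesgue_integral_def using test_function_zero_outside[OF p]
      by (intro Bochner_Integration.integral_cong) (auto simp: indicator_def)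
    also have "\<dots> \<le> 3 * T * (\<integral>x. \<bar>partial k \<phi> x\<bar> \<partial>lebesgue)" by (rule test_function_poincare[OF p T(2,1)])
    also have "\<dots> \<le> 3 * T * \<epsilon>" using 2 T by (intro mult_left_mono) auto
    finally have 3: "(LINT x:\<Omega>|lebesgue. \<bar>\<phi> x\<bar>) \<le> 3 * T * \<epsilon>" .
    have hi: "set_integrable lebesgue \<Omega> ?h" by (rule W1_integrable(1)[OF \<open>open \<Omega>\<close> hW])
    have "(LINT x:\<Omega>|lebesgue. \<bar>f x\<bar>) \<le> (LINT x:\<Omega>|lebesgue. \<bar>?h x\<bar> + \<bar>\<phi> x\<bar>)"
      using fi hi pi by (intro set_integral_mono set_integral_add set_integrable_abs) auto
    also have "\<dots> = (LINT x:\<Omega>|lebesgue. \<bar>?h x\<bar>) + (LINT x:\<Omega>|lebesgue. \<bar>\<phi> x\<bar>)"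
      using hi pi by (intro set_integral_add set_integrable_abs)
    finally show ?thesis using 1 3 by (simp add: algebra_simps)
  qed
  then have "(LINT x:\<Omega>|lebesgue. \<bar>f x\<bar>) \<le> 0 + \<delta>" if "\<delta> > 0" for \<delta>
  proof -
    have "\<delta> / (1 + 3 * T) > 0" using that T by simp
    from \<open>\<And>\<epsilon>. \<epsilon> > 0 \<Longrightarrow> (LINT x:\<Omega>|lebesgue. \<bar>f x\<bar>) \<le> (1 + 3 * T) * \<epsilon>\<close>[OF this]
    moreover have "(1 + 3 * T) * (\<delta> / (1 + 3 * T)) = \<delta>" using T by simp
    ultimately show ?thesis by simp
  qed
  then have le: "(LINT x:\<Omega>|lebesgue. \<bar>f x\<bar>) \<le> 0" by (rule field_le_epsilon)
  have i: "integrable lebesgue (\<lambda>x. indicator \<Omega> x *\<^sub>R \<bar>f x\<bar>)" using set_integrable_abs[OF fi] by (simp add: set_integrable_def)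
  have "(\<integral>x. indicator \<Omega> x *\<^sub>R \<bar>f x\<bar> \<partial>lebesgue) = 0"
    using le unfolding set_lebesgue_integral_def by (intro antisym) auto
  then have "AE x in lebesgue. indicator \<Omega> x *\<^sub>R \<bar>f x\<bar> = 0"
    using integral_nonneg_eq_0_iff_AE[OF i] by auto
  then show ?thesis by eventually_elim (auto simp: indicator_def)
qed

section \<open>Convexity of the generalized p-area\<close>

lemma p_area_integrable:
  fixes \<Omega> :: "(real ^ 'n::finite) set"
  assumes "open \<Omega>" and w: "w \<in> W1 1 \<Omega>" and F: "\<And>I. (\<lambda>x. F x $ I) \<in> L1 \<Omega>" and H: "H \<in> Linf \<Omega>"
  shows "set_integrable lebesgue \<Omega> (\<lambda>x. norm (weak_grad \<Omega> w x + F x))"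
    and "set_integrable lebesgue \<Omega> (\<lambda>x. H x * w x)"
proof -
  have c: "integrable lebesgue (\<lambda>x. indicator \<Omega> x * (weak_grad \<Omega> w x + F x) $ i)" for i
    using W1_D(2)[OF \<open>open \<Omega>\<close> w, of "[i]"] F[of i]
    by (simp add: L1_def set_integrable_def weak_grad_def distrib_left)
  have eq: "indicator \<Omega> x *\<^sub>R norm (weak_grad \<Omega> w x + F x) =
      sqrt (\<Sum>i\<in>UNIV. (indicator \<Omega> x * (weak_grad \<Omega> w x + F x) $ i)\<^sup>2)" for x
    by (simp add: norm_vec_def L2_set_def indicator_def)
  show "set_integrable lebesgue \<Omega> (\<lambda>x. norm (weak_grad \<Omega> w x + F x))"
    unfolding set_integrable_def
  proof (rule Bochner_Integration.integrable_bound)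
    show "integrable lebesgue (\<lambda>x. \<Sum>i\<in>UNIV. \<bar>indicator \<Omega> x * (weak_grad \<Omega> w x + F x) $ i\<bar>)"
      using c by (intro Bochner_Integration.integrable_sum integrable_abs)
    show "(\<lambda>x. indicator \<Omega> x *\<^sub>R norm (weak_grad \<Omega> w x + F x)) \<in> borel_measurable lebesgue"
      unfolding eq using c[THEN borel_measurable_integrable] by measurable
    show "AE x in lebesgue. norm (indicator \<Omega> x *\<^sub>R norm (weak_grad \<Omega> w x + F x))
        \<le> norm (\<Sum>i\<in>UNIV. \<bar>indicator \<Omega> x * (weak_grad \<Omega> w x + F x) $ i\<bar>)"
      by (intro AE_I2) (auto simp: indicator_def abs_of_nonneg sum_nonneg norm_le_l1_cart simp del: vector_add_component)
  qed
  obtain B where B: "AE x in lebesgue. x \<in> \<Omega> \<longrightarrow> \<bar>H x\<bar> \<le> B" and Hm: "set_borel_measurable lebesgue \<Omega> H"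
    using H unfolding Linf_def by blast
  have wi: "integrable lebesgue (\<lambda>x. indicator \<Omega> x *\<^sub>R w x)"
    using W1_integrable(1)[OF \<open>open \<Omega>\<close> w] by (simp add: set_integrable_def)
  have "integrable lebesgue (\<lambda>x. (indicator \<Omega> x *\<^sub>R H x) * (indicator \<Omega> x *\<^sub>R w x))"
  proof (rule Bochner_Integration.integrable_bound)
    show "integrable lebesgue (\<lambda>x. B * (indicator \<Omega> x *\<^sub>R w x))" using wi by simp
    show "(\<lambda>x. (indicator \<Omega> x *\<^sub>R H x) * (indicator \<Omega> x *\<^sub>R w x)) \<in> borel_measurable lebesgue"
      using Hm wi unfolding set_borel_measurable_def by (intro borel_measurable_times) auto
    show "AE x in lebesgue. norm ((indicator \<Omega> x *\<^sub>R H x) * (indicator \<Omega> x *\<^sub>R w x)) \<le> norm (B * (indicator \<Omega> x *\<^sub>R w x))"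
      using B by eventually_elim (auto simp: abs_mult indicator_def intro!: mult_right_mono)
  qed
  then show "set_integrable lebesgue \<Omega> (\<lambda>x. H x * w x)"
    unfolding set_integrable_def
    by (rule Bochner_Integration.integrable_cong[OF refl, THEN iffD1, rotated]) (auto simp: indicator_def)
qed

text \<open>The integrand \<open>g\<close> below is the sum of the integrands at \<open>u\<close> and \<open>v\<close> minus twice the one at the midpoint. The terms with \<open>H\<close> cancel, so \<open>g\<close> is
the defect of the triangle inequality and nonnegative; minimality makes its integral nonpositive.\<close>

lemma minimizers_same_direction:
  fixes \<Omega> :: "(real ^ 'n::finite) set"
  assumes "open \<Omega>" and F: "\<And>I. (\<lambda>x. F x $ I) \<in> L1 \<Omega>" and H: "H \<in> Linf \<Omega>"
    and u: "p_area_minimizer \<Omega> F H u" and v: "p_area_minimizer \<Omega> F H v"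
    and uv: "(\<lambda>x. u x - v x) \<in> W1_0 1 \<Omega>"
  shows "AE x in lebesgue. x \<in> \<Omega> \<longrightarrow> norm (weak_grad \<Omega> u x + F x) *\<^sub>R (weak_grad \<Omega> v x + F x) =
    norm (weak_grad \<Omega> v x + F x) *\<^sub>R (weak_grad \<Omega> u x + F x)"
proof -
  define m where "m x = 1/2 * u x + 1/2 * v x" for x
  have uW: "u \<in> W1 1 \<Omega>" and vW: "v \<in> W1 1 \<Omega>" using u v by (auto simp: p_area_minimizer_def)
  have mW: "m \<in> W1 1 \<Omega>" unfolding m_def by (rule W1_linear[OF uW vW])
  let ?a = "\<lambda>x. weak_grad \<Omega> u x + F x" and ?b = "\<lambda>x. weak_grad \<Omega> v x + F x" and ?m = "\<lambda>x. weak_grad \<Omega> m x + F x"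
  note ui = p_area_integrable[OF \<open>open \<Omega>\<close> uW F H]
  note vi = p_area_integrable[OF \<open>open \<Omega>\<close> vW F H]
  note mi = p_area_integrable[OF \<open>open \<Omega>\<close> mW F H]
  have m: "(\<lambda>x. u x + (- 1/2) * (u x - v x)) = m" "(\<lambda>x. v x + 1/2 * (u x - v x)) = m"
    by (auto simp: m_def fun_eq_iff field_simps)
  have "p_area \<Omega> F H u \<le> p_area \<Omega> F H (\<lambda>x. u x + (- 1/2) * (u x - v x))"
    "p_area \<Omega> F H v \<le> p_area \<Omega> F H (\<lambda>x. v x + 1/2 * (u x - v x))"
    by (rule bspec[OF conjunct2[OF u[unfolded p_area_minimizer_def]] W1_0_scale[OF \<open>open \<Omega>\<close> uv]],
        rule bspec[OF conjunct2[OF v[unfolded p_area_minimizer_def]] W1_0_scale[OF \<open>open \<Omega>\<close> uv]])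
  then have min: "p_area \<Omega> F H u \<le> p_area \<Omega> F H m" "p_area \<Omega> F H v \<le> p_area \<Omega> F H m"
    unfolding m .
  have "AE x in lebesgue. \<forall>i. x \<in> \<Omega> \<longrightarrow> weak_deriv \<Omega> [i] m x = 1/2 * weak_deriv \<Omega> [i] u x + 1/2 * weak_deriv \<Omega> [i] v x"
    unfolding AE_all_countable m_def by (intro allI weak_deriv_linear[OF \<open>open \<Omega>\<close> uW vW]) simp
  then have mm: "AE x in lebesgue. x \<in> \<Omega> \<longrightarrow> ?m x = (1/2) *\<^sub>R (?a x + ?b x)"
    by eventually_elim (auto simp: vec_eq_iff weak_grad_def field_simps)
  define g where "g x = (norm (?a x) + H x * u x) + (norm (?b x) + H x * v x) - 2 * (norm (?m x) + H x * m x)" for x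
  have gi: "set_integrable lebesgue \<Omega> g" unfolding g_def
    using ui vi mi by (intro set_integral_diff set_integral_add set_integrable_mult_right) auto
  have "(LINT x:\<Omega>|lebesgue. g x) = p_area \<Omega> F H u + p_area \<Omega> F H v - 2 * p_area \<Omega> F H m"
  proof -
    have s: "set_integrable lebesgue \<Omega> (\<lambda>x. norm (?a x) + H x * u x)"
      "set_integrable lebesgue \<Omega> (\<lambda>x. norm (?b x) + H x * v x)"
      "set_integrable lebesgue \<Omega> (\<lambda>x. norm (?m x) + H x * m x)"
      using ui vi mi by (auto intro!: set_integral_add(1))
    show ?thesis unfolding g_def p_area_def
      by (subst set_integral_diff(2), rule set_integral_add(1)[OF s(1,2)],
          rule set_integrable_mult_right[OF s(3)], subst set_integral_add(2)[OF s(1,2)],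
          subst set_integral_mult_right, rule refl)
  qed
  then have le: "(LINT x:\<Omega>|lebesgue. g x) \<le> 0" using min by simp
  have gx: "AE x in lebesgue. x \<in> \<Omega> \<longrightarrow> g x = norm (?a x) + norm (?b x) - norm (?a x + ?b x)"
    using mm
  proof eventually_elim
    case (elim x)
    show ?case
    proof
      assume "x \<in> \<Omega>"
      with elim have "norm (?m x) = norm (?a x + ?b x) / 2" by simp
      then show "g x = norm (?a x) + norm (?b x) - norm (?a x + ?b x)"
        unfolding g_def by (simp add: m_def algebra_simps)
    qed
  qed
  have nn: "AE x in lebesgue. 0 \<le> indicator \<Omega> x *\<^sub>R g x"
    using gx
  proof eventually_elim
    case (elim x)
    then show ?case using norm_triangle_ineq[of "?a x" "?b x"] by (cases "x \<in> \<Omega>") auto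
  qed
  have "(\<integral>x. indicator \<Omega> x *\<^sub>R g x \<partial>lebesgue) = 0"
    using le integral_nonneg_AE[OF nn] unfolding set_lebesgue_integral_def by simp
  then have "AE x in lebesgue. indicator \<Omega> x *\<^sub>R g x = 0"
    using integral_nonneg_eq_0_iff_AE[OF _ nn] gi unfolding set_integrable_def by blast
  with gx show ?thesis
  proof eventually_elim
    case (elim x)
    show ?case
    proof
      assume "x \<in> \<Omega>"
      with elim have "norm (?a x + ?b x) = norm (?a x) + norm (?b x)" by simp
      then show "norm (?a x) *\<^sub>R ?b x = norm (?b x) *\<^sub>R ?a x" by (rule norm_triangle_eq[THEN iffD1])
    qed
  qed
qed

section \<open>Wedge products in coordinates\<close>

lemma wedge_dx_dx: "wedge 1 1 (dx J) (dx I) X = X 0 $ J * X 1 $ I - X 1 $ J * X 0 $ I"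
proof -
  have [simp]: "{..<Suc (Suc 0)} = insert 0 {Suc 0}" by auto
  show ?thesis
    unfolding wedge_def dx_def
    by (simp add: sum_over_permutations_insert sign_compose permutation_swap_id permutes_sing sign_swap_id)
qed

text \<open>The six permutations combine in pairs, since the 2-form is alternating, to the cyclic sum
\<open>\<beta>(X\<^sub>0) \<gamma>(X\<^sub>1, X\<^sub>2) + \<beta>(X\<^sub>1) \<gamma>(X\<^sub>2, X\<^sub>0) + \<beta>(X\<^sub>2) \<gamma>(X\<^sub>0, X\<^sub>1)\<close>. The hypothesis says that its coefficients vanish.\<close>

lemma wedge_1_2_zero:
  fixes b :: "'n::finite \<Rightarrow> real" and D :: "'n \<Rightarrow> 'n \<Rightarrow> real"
  assumes cyc: "\<And>I J K. b I * (D J K - D K J) + b J * (D K I - D I K) + b K * (D I J - D J I) = 0"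
  shows "wedge 1 2 (\<lambda>X. \<Sum>I\<in>UNIV. b I * dx I X)
    (\<lambda>X. \<Sum>I\<in>UNIV. \<Sum>J\<in>UNIV. D I J * wedge 1 1 (dx J) (dx I) X) = (\<lambda>X. 0)"
proof
  fix X :: "nat \<Rightarrow> real ^ 'n"
  define \<beta> where "\<beta> y = (\<Sum>I\<in>UNIV. b I * y $ I)" for y :: "real ^ 'n"
  define \<gamma> where "\<gamma> y z = (\<Sum>I\<in>UNIV. \<Sum>J\<in>UNIV. D I J * (y $ J * z $ I - z $ J * y $ I))" for y z :: "real ^ 'n"
  have anti: "\<gamma> z y = - \<gamma> y z" for y z
    unfolding \<gamma>_def by (simp add: sum_negf[symmetric] algebra_simps)
  have set3: "{..<Suc (Suc (Suc 0))} = insert 0 (insert (Suc 0) {Suc (Suc 0)})" by auto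
  have "wedge 1 2 (\<lambda>X. \<Sum>I\<in>UNIV. b I * dx I X)
    (\<lambda>X. \<Sum>I\<in>UNIV. \<Sum>J\<in>UNIV. D I J * wedge 1 1 (dx J) (dx I) X) X =
    (\<Sum>\<sigma> | \<sigma> permutes {..<Suc (Suc (Suc 0))}. of_int (sign \<sigma>) * \<beta> (X (\<sigma> 0)) * \<gamma> (X (\<sigma> 1)) (X (\<sigma> 2))) / 2"
    unfolding wedge_dx_dx unfolding wedge_def[of 1 2] \<beta>_def \<gamma>_def dx_def by (simp add: numeral_eq_Suc)
  also have "\<dots> = \<beta> (X 0) * \<gamma> (X 1) (X 2) + \<beta> (X 1) * \<gamma> (X 2) (X 0) + \<beta> (X 2) * \<gamma> (X 0) (X 1)"
    unfolding set3
    using anti[of "X 1" "X 2"] anti[of "X 2" "X 0"] anti[of "X 0" "X 1"]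
    by (simp add: sum_over_permutations_insert sign_compose permutation_swap_id permutation_compose
        permutes_sing sign_swap_id transpose_def numeral_2_eq_2 field_simps)
  also have "\<dots> = 0"
  proof -
    have g: "\<gamma> y z = (\<Sum>I\<in>UNIV. \<Sum>J\<in>UNIV. (D I J - D J I) * (y $ J * z $ I))" for y z
    proof -
      have "\<gamma> y z = (\<Sum>I\<in>UNIV. \<Sum>J\<in>UNIV. D I J * (y $ J * z $ I)) - (\<Sum>I\<in>UNIV. \<Sum>J\<in>UNIV. D I J * (z $ J * y $ I))"
        unfolding \<gamma>_def by (simp add: sum_subtractf right_diff_distrib)
      also have "(\<Sum>I\<in>UNIV. \<Sum>J\<in>UNIV. D I J * (z $ J * y $ I)) = (\<Sum>I\<in>UNIV. \<Sum>J\<in>UNIV. D J I * (z $ I * y $ J))"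
        by (rule sum.swap)
      finally show ?thesis by (simp add: sum_subtractf left_diff_distrib mult.commute)
    qed
    let ?S = "\<lambda>f. \<Sum>I\<in>UNIV. \<Sum>J\<in>UNIV. \<Sum>K\<in>UNIV. f I J K :: real"
    have 1: "\<beta> (X 0) * \<gamma> (X 1) (X 2) = ?S (\<lambda>I J K. b K * (D I J - D J I) * (X 0 $ K * X 1 $ J * X 2 $ I))"
    proof -
      have "\<beta> (X 0) * \<gamma> (X 1) (X 2) = (\<Sum>K\<in>UNIV. \<Sum>I\<in>UNIV. \<Sum>J\<in>UNIV. b K * (D I J - D J I) * (X 0 $ K * X 1 $ J * X 2 $ I))"
        unfolding \<beta>_def g sum_distrib_right unfolding sum_distrib_left by (simp add: mult_ac)
      also have "\<dots> = (\<Sum>I\<in>UNIV. \<Sum>K\<in>UNIV. \<Sum>J\<in>UNIV. b K * (D I J - D J I) * (X 0 $ K * X 1 $ J * X 2 $ I))"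
        by (rule sum.swap)
      also have "\<dots> = ?S (\<lambda>I J K. b K * (D I J - D J I) * (X 0 $ K * X 1 $ J * X 2 $ I))"
        by (intro sum.cong refl sum.swap)
      finally show ?thesis .
    qed
    have 2: "\<beta> (X 1) * \<gamma> (X 2) (X 0) = ?S (\<lambda>I J K. b J * (D K I - D I K) * (X 0 $ K * X 1 $ J * X 2 $ I))"
    proof -
      have "\<beta> (X 1) * \<gamma> (X 2) (X 0) = (\<Sum>J\<in>UNIV. \<Sum>K\<in>UNIV. \<Sum>I\<in>UNIV. b J * (D K I - D I K) * (X 0 $ K * X 1 $ J * X 2 $ I))"
        unfolding \<beta>_def g sum_distrib_right unfolding sum_distrib_left by (simp add: mult_ac)
      also have "\<dots> = (\<Sum>J\<in>UNIV. \<Sum>I\<in>UNIV. \<Sum>K\<in>UNIV. b J * (D K I - D I K) * (X 0 $ K * X 1 $ J * X 2 $ I))"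
        by (intro sum.cong refl sum.swap)
      also have "\<dots> = ?S (\<lambda>I J K. b J * (D K I - D I K) * (X 0 $ K * X 1 $ J * X 2 $ I))"
        by (rule sum.swap)
      finally show ?thesis .
    qed
    have 3: "\<beta> (X 2) * \<gamma> (X 0) (X 1) = ?S (\<lambda>I J K. b I * (D J K - D K J) * (X 0 $ K * X 1 $ J * X 2 $ I))"
      unfolding \<beta>_def g sum_distrib_right unfolding sum_distrib_left by (simp add: mult_ac)
    have "\<beta> (X 0) * \<gamma> (X 1) (X 2) + \<beta> (X 1) * \<gamma> (X 2) (X 0) + \<beta> (X 2) * \<gamma> (X 0) (X 1) =
      ?S (\<lambda>I J K. (b I * (D J K - D K J) + b J * (D K I - D I K) + b K * (D I J - D J I)) * (X 0 $ K * X 1 $ J * X 2 $ I))"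
      unfolding 1 2 3 distrib_right sum.distrib by simp
    then show ?thesis by (simp add: cyc)
  qed
  finally show "wedge 1 2 (\<lambda>X. \<Sum>I\<in>UNIV. b I * dx I X)
    (\<lambda>X. \<Sum>I\<in>UNIV. \<Sum>J\<in>UNIV. D I J * wedge 1 1 (dx J) (dx I) X) X = 0" .
qed

section \<open>Uniqueness of minimizers\<close>

lemma has_weak_deriv_swap_iff: "has_weak_deriv \<Omega> [i, j] f = has_weak_deriv \<Omega> [j, i] f"
  using has_weak_deriv_swap by blast

text \<open>This is an equality of functions: the two orderings have the same weak derivatives, so the choice operator picks the same one.\<close>

lemma weak_deriv_swap: "weak_deriv \<Omega> [i, j] f = weak_deriv \<Omega> [j, i] f"
  unfolding weak_deriv_def by (subst has_weak_deriv_swap_iff) simp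

text \<open>In coordinates, \<open>a\<close> is the gradient of \<open>u - v\<close>, \<open>b\<close> the coefficient vector of \<open>\<Theta>\<^sub>u\<close>, and \<open>A\<close>, \<open>B\<close>, \<open>D\<close> are the derivatives of \<open>a\<close>, \<open>b\<close>
and \<open>F\<close>. Differentiating \<open>a\<^sub>I b\<^sub>J = a\<^sub>J b\<^sub>I\<close> in direction \<open>K\<close> and summing cyclically removes the symmetric second derivatives of
\<open>u\<close> and \<open>v\<close>; what is left is \<open>d(u - v) \<and> d\<Theta>\<^sub>u = 0\<close>.\<close>

lemma parallel_forms_gradient_zero:
  fixes \<Omega> :: "(real ^ 'n::finite) set"
  assumes "open \<Omega>" and F: "\<And>I. (\<lambda>x. F x $ I) \<in> W 1 \<Omega>" and u: "u \<in> W1 2 \<Omega>" and v: "v \<in> W1 2 \<Omega>"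
    and par: "AE x in lebesgue. x \<in> \<Omega> \<longrightarrow> (\<forall>I J.
      (weak_deriv \<Omega> [I] u x - weak_deriv \<Omega> [I] v x) * (weak_deriv \<Omega> [J] u x + F x $ J) =
      (weak_deriv \<Omega> [J] u x - weak_deriv \<Omega> [J] v x) * (weak_deriv \<Omega> [I] u x + F x $ I))"
    and non: "nonintegrable \<Omega> F u"
  shows "AE x in lebesgue. x \<in> \<Omega> \<longrightarrow> (\<forall>I. weak_deriv \<Omega> [I] u x = weak_deriv \<Omega> [I] v x)"
proof -
  define a where "a I x = 1 * weak_deriv \<Omega> [I] u x + (-1) * weak_deriv \<Omega> [I] v x" for I x
  define b where "b I x = 1 * weak_deriv \<Omega> [I] u x + 1 * F x $ I" for I x
  define A where "A I K x = 1 * weak_deriv \<Omega> [I, K] u x + (-1) * weak_deriv \<Omega> [I, K] v x" for I K x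
  define D where "D I K = weak_deriv \<Omega> [K] (\<lambda>y. F y $ I)" for I K
  define B where "B I K x = 1 * weak_deriv \<Omega> [I, K] u x + 1 * D I K x" for I K x
  have h: "has_weak_deriv \<Omega> [K] (weak_deriv \<Omega> [I] w) (weak_deriv \<Omega> [I, K] w)" if "w \<in> W1 2 \<Omega>" for w I K
    by (rule weak_deriv_of_weak_deriv[OF W1_D(1)[OF \<open>open \<Omega>\<close> that] W1_D(1)[OF \<open>open \<Omega>\<close> that]]) auto
  have hF: "has_weak_deriv \<Omega> [K] (\<lambda>x. F x $ I) (D I K)" for I K
  proof -
    obtain g where "has_weak_deriv \<Omega> [K] (\<lambda>x. F x $ I) g" using F[of I] unfolding W_def by (auto dest!: spec[of _ "[K]"])
    then show ?thesis unfolding D_def by (rule has_weak_deriv_weak_deriv)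
  qed
  have ha: "has_weak_deriv \<Omega> [K] (a I) (A I K)" for I K
    unfolding a_def A_def by (intro has_weak_deriv_linear h u v)
  have hb: "has_weak_deriv \<Omega> [K] (b I) (B I K)" for I K
    unfolding b_def B_def by (intro has_weak_deriv_linear h hF u)
  have "AE x in lebesgue. x \<in> \<Omega> \<longrightarrow> A I K x * b J x + a I x * B J K x = A J K x * b I x + a J x * B I K x" for I J K
  proof (rule formal_product_rule[OF \<open>open \<Omega>\<close> ha hb ha hb])
    show "AE x in lebesgue. x \<in> \<Omega> \<longrightarrow> a I x * b J x = a J x * b I x"
      using par by eventually_elim (simp add: a_def b_def)
  qed
  then have "AE x in lebesgue. \<forall>I J K. x \<in> \<Omega> \<longrightarrow> A I K x * b J x + a I x * B J K x = A J K x * b I x + a J x * B I K x"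
    unfolding AE_all_countable by blast
  then have "AE x in lebesgue. x \<in> \<Omega> \<longrightarrow> (\<forall>I. a I x = 0)"
    using par non[unfolded nonintegrable_def]
  proof eventually_elim
    case (elim x)
    show ?case
    proof (intro impI, rule ccontr)
      assume x: "x \<in> \<Omega>" and "\<not> (\<forall>I. a I x = 0)"
      then obtain I0 where I0: "a I0 x \<noteq> 0" by blast
      \<comment> \<open>At this point \<open>\<Theta>\<^sub>u = g d(u - v)\<close>.\<close>
      define g where "g = b I0 x / a I0 x"
      have bg: "b I x = g * a I x" for I
        using elim(2) x I0 unfolding g_def by (simp add: a_def b_def field_simps)
      have sym: "A I K x = A K I x" "weak_deriv \<Omega> [I, K] u x = weak_deriv \<Omega> [K, I] u x" for I K
        unfolding A_def using weak_deriv_swap[of \<Omega> I K] by auto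
      have cyca: "a I x * (D J K x - D K J x) + a J x * (D K I x - D I K x) + a K x * (D I J x - D J I x) = 0" for I J K
      proof -
        \<comment> \<open>Adding the three cyclic instances, each second derivative in \<open>A\<close> meets its mirror image with the opposite sign.\<close>
        have e: "A I K x * b J x + a I x * B J K x = A J K x * b I x + a J x * B I K x"
          "A J I x * b K x + a J x * B K I x = A K I x * b J x + a K x * B J I x"
          "A K J x * b I x + a K x * B I J x = A I J x * b K x + a I x * B K J x"
          using elim(1) x by blast+
        have s: "A K I x = A I K x" "A J I x = A I J x" "A K J x = A J K x" using sym(1) by auto
        have "a I x * (B J K x - B K J x) + a J x * (B K I x - B I K x) + a K x * (B I J x - B J I x) = 0"
          using e unfolding s by (simp add: algebra_simps)
        then show ?thesis unfolding B_def using sym(2)[of I J] sym(2)[of J K] sym(2)[of K I] by simp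
      qed
      have cyc: "b I x * (D J K x - D K J x) + b J x * (D K I x - D I K x) + b K x * (D I J x - D J I x) = 0" for I J K
      proof -
        have "b I x * (D J K x - D K J x) + b J x * (D K I x - D I K x) + b K x * (D I J x - D J I x) =
          g * (a I x * (D J K x - D K J x) + a J x * (D K I x - D I K x) + a K x * (D I J x - D J I x))"
          unfolding bg by (simp add: algebra_simps)
        then show ?thesis by (simp add: cyca)
      qed
      have T: "Theta \<Omega> F u x = (\<lambda>X. \<Sum>I\<in>UNIV. b I x * dx I X)"
        by (auto simp: fun_eq_iff Theta_def b_def distrib_right sum.distrib)
      have dT: "dTheta \<Omega> F x = (\<lambda>X. \<Sum>I\<in>UNIV. \<Sum>J\<in>UNIV. D I J x * wedge 1 1 (dx J) (dx I) X)"
        by (auto simp: fun_eq_iff dTheta_def D_def)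
      show False
        using elim(3) x wedge_1_2_zero[of "\<lambda>I. b I x" "\<lambda>I J. D I J x", OF cyc] unfolding T dT by simp
    qed
  qed
  then show ?thesis by eventually_elim (simp add: a_def)
qed

lemma parallel_difference:
  fixes p q :: "real ^ 'n"
  assumes "norm p *\<^sub>R q = norm q *\<^sub>R p" "p \<noteq> 0"
  shows "(p $ I - q $ I) * p $ J = (p $ J - q $ J) * p $ I"
proof -
  have "q = (norm q / norm p) *\<^sub>R p"
    using assms by (metis (no_types) divide_inverse_commute left_inverse norm_eq_zero scaleR_one scaleR_scaleR)
  then obtain c where q: "q = c *\<^sub>R p" by blast
  show ?thesis unfolding q by (simp add: algebra_simps)
qed

lemma minimizers_equal_if_first_nonintegrable:
  fixes \<Omega> :: "(real ^ 'n::finite) set"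
  assumes "open \<Omega>" "bounded \<Omega>" and F: "\<And>I. (\<lambda>x. F x $ I) \<in> W 1 \<Omega> \<inter> L1 \<Omega>" and H: "H \<in> Linf \<Omega>"
    and u: "u \<in> W1 2 \<Omega>" and v: "v \<in> W1 2 \<Omega>"
    and um: "p_area_minimizer \<Omega> F H u" and vm: "p_area_minimizer \<Omega> F H v"
    and uv: "(\<lambda>x. u x - v x) \<in> W1_0 1 \<Omega>"
    and "C > 0" and C: "AE x\<in>\<Omega> in lebesgue. norm (weak_grad \<Omega> u x + F x) \<ge> C"
    and non: "nonintegrable \<Omega> F u"
  shows "AE x\<in>\<Omega> in lebesgue. u x = v x"
proof -
  have dir: "AE x in lebesgue. x \<in> \<Omega> \<longrightarrow> norm (weak_grad \<Omega> u x + F x) *\<^sub>R (weak_grad \<Omega> v x + F x) =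
    norm (weak_grad \<Omega> v x + F x) *\<^sub>R (weak_grad \<Omega> u x + F x)"
    using F by (intro minimizers_same_direction[OF \<open>open \<Omega>\<close> _ H um vm uv]) auto
  have "AE x in lebesgue. x \<in> \<Omega> \<longrightarrow> (\<forall>I J.
      (weak_deriv \<Omega> [I] u x - weak_deriv \<Omega> [I] v x) * (weak_deriv \<Omega> [J] u x + F x $ J) =
      (weak_deriv \<Omega> [J] u x - weak_deriv \<Omega> [J] v x) * (weak_deriv \<Omega> [I] u x + F x $ I))"
    using dir C
  proof eventually_elim
    case (elim x)
    show ?case
    proof (intro impI allI)
      fix I J assume x: "x \<in> \<Omega>"
      have "weak_grad \<Omega> u x + F x \<noteq> 0" using elim(2) x \<open>C > 0\<close> by (metis norm_zero not_le)
      from parallel_difference[OF _ this, of "weak_grad \<Omega> v x + F x" I J] elim(1) x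
      show "(weak_deriv \<Omega> [I] u x - weak_deriv \<Omega> [I] v x) * (weak_deriv \<Omega> [J] u x + F x $ J) =
        (weak_deriv \<Omega> [J] u x - weak_deriv \<Omega> [J] v x) * (weak_deriv \<Omega> [I] u x + F x $ I)"
        by (simp add: weak_grad_def)
    qed
  qed
  then have grad: "AE x in lebesgue. x \<in> \<Omega> \<longrightarrow> (\<forall>I. weak_deriv \<Omega> [I] u x = weak_deriv \<Omega> [I] v x)"
    using F by (intro parallel_forms_gradient_zero[OF \<open>open \<Omega>\<close> _ u v _ non]) auto
  have z: "AE x in lebesgue. x \<in> \<Omega> \<longrightarrow> weak_deriv \<Omega> [k] (\<lambda>x. u x - v x) x = 0" for k
    using weak_deriv_linear[OF \<open>open \<Omega>\<close> u v, of "[k]" 1 "-1", simplified] grad by eventually_elim simp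
  have "AE x in lebesgue. x \<in> \<Omega> \<longrightarrow> u x - v x = 0"
    by (rule W1_0_zero_gradient[OF \<open>open \<Omega>\<close> \<open>bounded \<Omega>\<close> uv z])
  then show ?thesis by eventually_elim simp
qed

theorem mainTheorem7:
  fixes \<Omega> :: "(real ^ 'n::finite) set"
    and F :: "real ^ 'n \<Rightarrow> real ^ 'n"
    and H u v :: "real ^ 'n \<Rightarrow> real"
    and C :: real
  assumes "open \<Omega>" and "connected \<Omega>" and "\<Omega> \<noteq> {}" and "bounded \<Omega>"
    and "\<And>I. (\<lambda>x. F x $ I) \<in> W 1 \<Omega> \<inter> L1 \<Omega>"
    and "H \<in> Linf \<Omega>"
    and "u \<in> W1 2 \<Omega>" and "v \<in> W1 2 \<Omega>"
    and "p_area_minimizer \<Omega> F H u" and "p_area_minimizer \<Omega> F H v"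
    and "(\<lambda>x. u x - v x) \<in> W1_0 2 \<Omega>"
    and "C > 0"
    and "AE x\<in>\<Omega> in lebesgue. norm (weak_grad \<Omega> u x + F x) \<ge> C"
    and "AE x\<in>\<Omega> in lebesgue. norm (weak_grad \<Omega> v x + F x) \<ge> C"
    and "nonintegrable \<Omega> F u \<or> nonintegrable \<Omega> F v"
  shows "AE x\<in>\<Omega> in lebesgue. u x = v x"
proof -
  have uv: "(\<lambda>x. u x - v x) \<in> W1_0 1 \<Omega>"
    using assms(11) W1_0_mono[of 1 2 \<Omega>] by auto
  have vu: "(\<lambda>x. v x - u x) \<in> W1_0 1 \<Omega>"
    using W1_0_scale[OF assms(1) uv, of "-1"] by simp
  from assms(15) show ?thesis
  proof
    assume "nonintegrable \<Omega> F u"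
    from minimizers_equal_if_first_nonintegrable[OF assms(1,4,5,6,7,8,9,10) uv assms(12,13) this] show ?thesis .
  next
    assume "nonintegrable \<Omega> F v"
    from minimizers_equal_if_first_nonintegrable[OF assms(1,4,5,6,8,7,10,9) vu assms(12,14) this] show ?thesis
      by eventually_elim simp
  qed
qed

end
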